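(* Let $(p_m)_{m\ge2}$ be a sequence with $p_m>m$ for every $m\ge2$. (i) If $p_m/m\to1$, then $$\bigl(H^{\mathrm{pol}}_{m,p_m}(\mathbb C)\bigr)^{1/m}\longrightarrow1,\qquad \bigl(H^{\mathrm{pol}}_{m,p_m}(\mathbb R)\bigr)^{1/m}\longrightarrow2.$$ Both limits are uniform for $m<p\le m+h_m$ whenever $h_m>0$ and $h_m/m\to0$; that is, for such $(h_m)$, $$\sup_{m<p\le m+h_m}\left|\bigl(H^{\mathrm{pol}}_{m,p}(\mathbb C)\bigr)^{1/m}-1\right|\to0\quad\text{and}\quad \sup_{m<p\le m+h_m}\left|\bigl(H^{\mathrm{pol}}_{m,p}(\mathbb R)\bigr)^{1/m}-2\right|\to0.$$ (ii) If $p_m-m=o(\log m)$, then $H^{\mathrm{pol}}_{m,p_m}(\mathbb C)=m^{1+o(1)}$. (iii) If $p_m-m\to0$, then $H^{\mathrm{pol}}_{m,p_m}(\mathbb C)/m\to1$. (iv) For every fixed $h>0$, there are constants $c_h,C_h>0$ such that $$c_hm\le H^{\mathrm{pol}}_{m,m+h}(\mathbb C)\le C_hm$$ for all sufficiently large $m$.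
   Context: For $m,n\in\mathbb N=\{1,2,\dots\}$ and $\mathbb K\in\{\mathbb R,\mathbb C\}$, let $\mathcal M_m(n)=\{\alpha\in\mathbb N_0^n:\ |\alpha|=\alpha_1+\cdots+\alpha_n=m\}$, and let $\mathcal P_m(\mathbb K^n)$ be the space of $m$-homogeneous polynomials $P(z)=\sum_{\alpha\in\mathcal M_m(n)}a_\alpha z^\alpha$ on $\mathbb K^n$ with coefficients in $\mathbb K$. Put $\|P\|_p=\sup\{|P(z)|: z\in\mathbb K^n,\ \|z\|_p\le1\}$, where $\|z\|_p=(\sum_j|z_j|^p)^{1/p}$ for $p<\infty$ and $\|z\|_\infty=\max_j|z_j|$, and $|P|_r=(\sum_\alpha|a_\alpha|^r)^{1/r}$ for $1\le r<\infty$. For $m<p\le\infty$ set $q(m,p)=\frac{p}{p-m}$ if $m<p<2m$; $q(m,p)=\frac{2mp}{mp+p-2m}$ if $2m\le p<\infty$; $q(m,p)=\frac{2m}{m+1}$ if $p=\infty$. $H^{\mathrm{pol}}_{m,p}(\mathbb K)$ denotes the least constant $C$ such that $|P|_{q(m,p)}\le C\|P\|_p$ for all $n\in\mathbb N$ and all $P\in\mathcal P_m(\mathbb K^n)$ (finite by the polynomial Hardy--Littlewood inequality). *)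

theory Defs
  imports Complex_Main "HOL-Library.Extended_Real"
begin

text \<open>
  Vectors of length \<open>n\<close> are functions on \<open>nat\<close> of which only the values at \<open>j < n\<close> are used.
  An \<open>m\<close>-homogeneous polynomial in \<open>n\<close> variables is given by its coefficient family \<open>a\<close>, of which
  only the values on \<open>multi_indices m n\<close> are used. The scalar field is the type \<open>'k\<close>, to be
  instantiated with \<open>real\<close> or \<open>complex\<close>.
\<close>

definition multi_indices :: "nat \<Rightarrow> nat \<Rightarrow> (nat \<Rightarrow> nat) set" where
  "multi_indices m n = {\<alpha>. (\<forall>j\<ge>n. \<alpha> j = 0) \<and> (\<Sum>j<n. \<alpha> j) = m}"

definition hpoly_eval ::
  "nat \<Rightarrow> nat \<Rightarrow> ((nat \<Rightarrow> nat) \<Rightarrow> 'k::real_normed_field) \<Rightarrow> (nat \<Rightarrow> 'k) \<Rightarrow> 'k" where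
  "hpoly_eval m n a z = (\<Sum>\<alpha>\<in>multi_indices m n. a \<alpha> * (\<Prod>j<n. z j ^ \<alpha> j))"

text \<open>Meaningful for \<open>0 < p\<close> (possibly \<open>p = \<infinity>\<close>) and \<open>n \<ge> 1\<close>.\<close>

definition lp_norm :: "ereal \<Rightarrow> nat \<Rightarrow> (nat \<Rightarrow> 'k::real_normed_field) \<Rightarrow> real" where
  "lp_norm p n z =
     (if p = \<infinity> then Max ((\<lambda>j. norm (z j)) ` {..<n})
      else (\<Sum>j<n. norm (z j) powr real_of_ereal p) powr (1 / real_of_ereal p))"

definition hpoly_sup_norm ::
  "ereal \<Rightarrow> nat \<Rightarrow> nat \<Rightarrow> ((nat \<Rightarrow> nat) \<Rightarrow> 'k::real_normed_field) \<Rightarrow> real" where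
  "hpoly_sup_norm p m n a = (SUP z\<in>{z. lp_norm p n z \<le> 1}. norm (hpoly_eval m n a z))"

definition hpoly_coeff_norm ::
  "real \<Rightarrow> nat \<Rightarrow> nat \<Rightarrow> ((nat \<Rightarrow> nat) \<Rightarrow> 'k::real_normed_field) \<Rightarrow> real" where
  "hpoly_coeff_norm r m n a = (\<Sum>\<alpha>\<in>multi_indices m n. norm (a \<alpha>) powr r) powr (1 / r)"

definition HL_exponent :: "nat \<Rightarrow> ereal \<Rightarrow> real" where
  "HL_exponent m p =
     (if p = \<infinity> then 2 * real m / (real m + 1)
      else let s = real_of_ereal p in
        if s < 2 * real m then s / (s - real m)
        else 2 * real m * s / (real m * s + s - 2 * real m))"

text \<open>
  The least constant in the polynomial Hardy--Littlewood inequality; the type argument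
  selects the scalar field.
\<close>

definition H_pol :: "'k::real_normed_field itself \<Rightarrow> nat \<Rightarrow> ereal \<Rightarrow> real" where
  "H_pol K m p =
     (LEAST C::real. \<forall>n\<ge>1. \<forall>a :: (nat \<Rightarrow> nat) \<Rightarrow> 'k.
        hpoly_coeff_norm (HL_exponent m p) m n a \<le> C * hpoly_sup_norm p m n a)"

end

theory Submission
  imports Defs "HOL-Complex_Analysis.Conformal_Mappings" "HOL-Real_Asymp.Real_Asymp"
begin

text \<open>
  Write \<open>q = p / (p - m)\<close> for the exponent when \<open>m < p < 2 * m\<close>, and write \<open>H(C)\<close> and \<open>H(R)\<close> for
  the complex and the real constant. All parts of the theorem follow from bounds in this range of
  \<open>p\<close> alone: with an absolute constant \<open>L\<close>,
    \<open>m * exp (- L * (p - m)) \<le> H(C) \<le> m * exp (L * (p - m))\<close> and \<open>H(R) \<le> 2 ^ m * H(C)\<close>,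
  and \<open>H(R) powr (1 / m)\<close> is eventually larger than any number below \<open>2\<close>, uniformly in \<open>p\<close>.

  The complex lower bound comes from the single monomial \<open>z_1 \<cdots> z_m\<close>, whose maximum on the unit
  ball is \<open>m powr (- (m / p))\<close> by the inequality of the means.

  The complex upper bound \<open>|P|_q \<le> (128 * e) powr (m / q) * m powr (m / p) * ||P||_p\<close> rests on the
  observation that \<open>m / q = m * (p - m) / p \<le> p - m\<close>: a factor \<open>K ^ m\<close> lost in the sum
  \<open>R = \<Sum> |a_\<alpha>| powr q\<close> is harmless, whereas whatever is done to the norms themselves must be sharp.
  A random colouring of the variables with \<open>m\<close> colours loses only \<open>e ^ m\<close>, and a choice of the degree
  in each colour loses only \<open>4 ^ m\<close>, so one may restrict attention to multi-indices that have exactly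
  one variable in each colour class that they meet, to a prescribed power \<open>d l\<close>
  (\<open>exists_homogeneous_colouring\<close>). For one colour class \<open>V\<close> and weights \<open>w\<close> in the unit ball,
  rotating the variables of \<open>V\<close> by roots of unity isolates the terms that contain one variable of
  \<open>V\<close> to the power \<open>d l\<close>, and the phases of these variables can then be aligned; averaging over the
  other variables gives
    \<open>\<Sum>_{j \<in> V} (\<Sum>_{\<alpha> \<ni> j} |a_\<alpha> w^\<alpha>| powr q) powr (1 / q) \<le> 32 powr (m / q) * ||P||_p\<close>
  (\<open>aligned_lq_bound\<close>). The constant is an interpolation between the trivial estimate of a
  coefficient by the mean value, with constant \<open>1\<close>, and the comparison of the first with the second
  moment, with constant of order \<open>2 ^ m\<close>. It remains to choose \<open>w\<close> and \<open>V\<close>. Regard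
  \<open>|a_\<alpha>| powr q / R\<close> as a probability distribution of \<open>\<alpha>\<close>; then each colour carries a random variable, and
  one takes for \<open>w_j powr p\<close> its distribution, weighted by \<open>d l / m\<close>. After two applications of
  Jensen's inequality the left-hand side is bounded below by an expression in which only the
  entropies of these random variables occur, and they have the right sign if \<open>V\<close> is a colour of
  maximal entropy (\<open>entropy_lower_bound\<close>). What is left is \<open>R powr (1 / q) * m powr (- (m / p))\<close>.

  A real form is compared with its complexification by the maximum principle, applied to
  \<open>\<zeta> \<mapsto> P (z + \<zeta> * cnj z)\<close>, at the cost of \<open>2 ^ m\<close>. That this is optimal to exponential order is shown
  by iterating \<open>x^2 - y^2\<close>: in degree \<open>d = 2 ^ k\<close> this gives a real form in \<open>d\<close> variables that is bounded
  by \<open>1\<close> on the real cube but takes a value of modulus \<open>2 ^ (d - 1)\<close> on the torus. Its powers have few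
  coefficients, so one of them is large.
\<close>

section \<open>Multi-indices and norms\<close>

lemma multi_indices_le:
  assumes "\<alpha> \<in> multi_indices m n"
  shows "\<alpha> j \<le> m"
proof (cases "j < n")
  case True
  have "\<alpha> j \<le> (\<Sum>j<n. \<alpha> j)" using True by (intro member_le_sum) auto
  then show ?thesis using assms by (simp add: multi_indices_def)
qed (use assms in \<open>auto simp: multi_indices_def\<close>)

lemma sum_multi_index:
  "\<alpha> \<in> multi_indices m n \<Longrightarrow> (\<Sum>j<n. \<alpha> j) = m"
  by (simp add: multi_indices_def)

lemma multi_indices_eqI:
  assumes "\<alpha> \<in> multi_indices m n" "\<beta> \<in> multi_indices k n" "\<And>j. j < n \<Longrightarrow> \<alpha> j = \<beta> j"
  shows "\<alpha> = \<beta>"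
proof
  fix j show "\<alpha> j = \<beta> j"
    using assms by (cases "j < n") (auto simp: multi_indices_def)
qed

text \<open>
  Multi-indices vanish from \<open>n\<close> on, so they are determined by their restrictions, which live in
  a finite product. Both cardinality estimates below are read off from this embedding.
\<close>

lemma inj_on_restrict_multi_indices:
  "inj_on (\<lambda>\<alpha>. restrict \<alpha> {..<n}) (multi_indices m n)"
proof (rule inj_onI)
  fix \<alpha> \<beta> assume *: "\<alpha> \<in> multi_indices m n" "\<beta> \<in> multi_indices m n"
    "restrict \<alpha> {..<n} = restrict \<beta> {..<n}"
  show "\<alpha> = \<beta>"
    by (rule multi_indices_eqI[OF *(1,2)]) (metis *(3) lessThan_iff restrict_apply')
qed

lemma restrict_multi_indices_subset:
  "(\<lambda>\<alpha>. restrict \<alpha> {..<n}) ` multi_indices m n \<subseteq> PiE {..<n} (\<lambda>_. {..m})"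
  using multi_indices_le by (auto simp: PiE_def Pi_def)

lemma finite_multi_indices [simp, intro]: "finite (multi_indices m n)"
  using inj_on_finite[OF inj_on_restrict_multi_indices restrict_multi_indices_subset]
  by (simp add: finite_PiE)

lemma card_multi_indices_le_power: "card (multi_indices m n) \<le> (m + 1) ^ n"
  using card_inj_on_le[OF inj_on_restrict_multi_indices restrict_multi_indices_subset]
  by (simp add: finite_PiE card_PiE)

text \<open>
  Give each multi-index the weight \<open>2 ^ (- m)\<close>. It is a product over the coordinates, and the sum over
  a single coordinate is a geometric series bounded by \<open>2\<close>.
\<close>

lemma card_multi_indices_le_two_power: "card (multi_indices m n) \<le> 2 ^ (m + n)"
proof -
  have "real (card (multi_indices m n)) * (1/2) ^ m
      = (\<Sum>\<alpha>\<in>multi_indices m n. \<Prod>j<n. (1/2) ^ (restrict \<alpha> {..<n} j))"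
    by (simp add: power_sum[symmetric] sum_multi_index)
  also have "\<dots> = (\<Sum>\<beta>\<in>(\<lambda>\<alpha>. restrict \<alpha> {..<n}) ` multi_indices m n. \<Prod>j<n. (1/2) ^ \<beta> j)"
    by (subst sum.reindex[OF inj_on_restrict_multi_indices]) simp
  also have "\<dots> \<le> (\<Sum>\<beta>\<in>PiE {..<n} (\<lambda>_. {..m}). \<Prod>j<n. (1/2) ^ \<beta> j)"
    by (intro sum_mono2 restrict_multi_indices_subset finite_PiE prod_nonneg) auto
  also have "\<dots> = (\<Prod>j<n. \<Sum>t\<le>m. (1/2) ^ t)"
    by (subst prod_sum_PiE) auto
  also have "\<dots> \<le> (\<Prod>j<n. (2::real))"
  proof (intro prod_mono conjI)
    have "(\<Sum>t\<le>m. (1/2::real) ^ t) \<le> 2"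
      using power_le_one[of "1/2::real" m] by (simp add: sum_gp0)
    then show "(\<Sum>t\<le>m. (1/2::real) ^ t) \<le> 2" for j .
  qed (auto intro: sum_nonneg)
  finally have "real (card (multi_indices m n)) * (1/2) ^ m \<le> 2 ^ n" by simp
  then have "real (card (multi_indices m n)) \<le> 2 ^ n * 2 ^ m"
    by (simp add: power_one_over field_simps)
  then have "real (card (multi_indices m n)) \<le> real (2 ^ (m + n))"
    by (simp add: power_add mult.commute)
  then show ?thesis by (rule of_nat_le_iff[THEN iffD1])
qed

lemma norm_hpoly_eval_le_sum:
  assumes "\<And>j. j < n \<Longrightarrow> norm (z j) \<le> 1"
  shows "norm (hpoly_eval m n a z) \<le> (\<Sum>\<alpha>\<in>multi_indices m n. norm (a \<alpha>))"
  unfolding hpoly_eval_def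
proof (rule sum_norm_le)
  fix \<alpha>
  have "(\<Prod>j<n. norm (z j) ^ \<alpha> j) \<le> 1"
    using assms by (intro prod_le_1) (auto intro: power_le_one)
  then show "norm (a \<alpha> * (\<Prod>j<n. z j ^ \<alpha> j)) \<le> norm (a \<alpha>)"
    by (simp add: norm_mult norm_power prod_norm[symmetric] mult_left_le)
qed

lemma lp_norm_le_one_iff:
  assumes "0 < s"
  shows "lp_norm (ereal s) n z \<le> 1 \<longleftrightarrow> (\<Sum>j<n. norm (z j) powr s) \<le> 1"
proof -
  let ?S = "\<Sum>j<n. norm (z j) powr s"
  have "?S powr (1 / s) \<le> 1 \<longleftrightarrow> ?S \<le> 1"
  proof
    assume *: "?S powr (1 / s) \<le> 1"
    have "?S = (?S powr (1 / s)) powr s"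
      using assms by (simp add: powr_powr sum_nonneg)
    also have "\<dots> \<le> 1 powr s"
      using * assms by (intro powr_mono2) auto
    finally show "?S \<le> 1" by simp
  next
    assume "?S \<le> 1"
    then have "?S powr (1/s) \<le> 1 powr (1/s)"
      using assms by (intro powr_mono2) (auto simp: sum_nonneg)
    then show "?S powr (1/s) \<le> 1" by simp
  qed
  then show ?thesis by (simp add: lp_norm_def)
qed

lemma lp_norm_le_oneD:
  assumes "0 < s" "lp_norm (ereal s) n z \<le> 1" "j < n"
  shows "norm (z j) \<le> 1"
proof (rule ccontr)
  assume "\<not> norm (z j) \<le> 1"
  then have "1 < norm (z j) powr s" using assms(1) by (simp add: gr_one_powr)
  also have "\<dots> \<le> (\<Sum>j<n. norm (z j) powr s)"
    using assms(3) by (intro member_le_sum) auto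
  finally show False using assms lp_norm_le_one_iff by force
qed

lemma hpoly_eval_le_sup_norm:
  assumes "0 < s" "lp_norm (ereal s) n z \<le> 1"
  shows "norm (hpoly_eval m n a z) \<le> hpoly_sup_norm (ereal s) m n a"
  unfolding hpoly_sup_norm_def
proof (rule cSUP_upper)
  show "bdd_above ((\<lambda>z. norm (hpoly_eval m n a z)) ` {z. lp_norm (ereal s) n z \<le> 1})"
    using norm_hpoly_eval_le_sum lp_norm_le_oneD[OF assms(1)]
    by (intro bdd_aboveI2[where M = "\<Sum>\<alpha>\<in>multi_indices m n. norm (a \<alpha>)"]) blast
qed (use assms in simp)

lemma lp_norm_zero_le: "0 < s \<Longrightarrow> lp_norm (ereal s) n (\<lambda>_. 0) \<le> 1"
  by (simp add: lp_norm_le_one_iff)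

lemma hpoly_sup_norm_nonneg: "0 < s \<Longrightarrow> 0 \<le> hpoly_sup_norm (ereal s) m n a"
  using hpoly_eval_le_sup_norm[OF _ lp_norm_zero_le] norm_ge_zero order_trans by blast

lemma hpoly_sup_norm_leI:
  assumes "0 < s" "\<And>z. lp_norm (ereal s) n z \<le> 1 \<Longrightarrow> norm (hpoly_eval m n a z) \<le> B"
  shows "hpoly_sup_norm (ereal s) m n a \<le> B"
  unfolding hpoly_sup_norm_def
  by (rule cSUP_least) (use assms lp_norm_zero_le[OF assms(1)] in auto)

text \<open>
  Terms with equal exponents are collected. This is how products of forms, which are given as sums
  over pairs of multi-indices, are turned back into coefficient families.
\<close>

lemma sum_monomials_eq_hpoly_eval:
  assumes "finite I" "\<And>i. i \<in> I \<Longrightarrow> \<beta> i \<in> multi_indices m n"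
  shows "(\<Sum>i\<in>I. c i * (\<Prod>j<n. z j ^ \<beta> i j))
       = hpoly_eval m n (\<lambda>\<alpha>. \<Sum>i\<in>{i\<in>I. \<beta> i = \<alpha>}. c i) z"
proof -
  have "hpoly_eval m n (\<lambda>\<alpha>. \<Sum>i\<in>{i\<in>I. \<beta> i = \<alpha>}. c i) z
      = (\<Sum>\<alpha>\<in>multi_indices m n. \<Sum>i\<in>{i\<in>I. \<beta> i = \<alpha>}. c i * (\<Prod>j<n. z j ^ \<beta> i j))"
    unfolding hpoly_eval_def by (intro sum.cong refl) (simp add: sum_distrib_right)
  also have "\<dots> = (\<Sum>i\<in>I. c i * (\<Prod>j<n. z j ^ \<beta> i j))"
    using assms by (intro sum.group) auto
  finally show ?thesis by simp
qed

section \<open>The least constant\<close>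

lemma HL_exponent_eq:
  assumes "real m < s" "s < 2 * real m"
  shows "HL_exponent m (ereal s) = s / (s - real m)"
  using assms by (simp add: HL_exponent_def Let_def)

text \<open>
  The predicate whose least solution \<open>C\<close> is the constant \<open>H_pol\<close>.
\<close>

definition HL_bound :: "'k::real_normed_field itself \<Rightarrow> nat \<Rightarrow> ereal \<Rightarrow> real \<Rightarrow> bool" where
  "HL_bound K m p C \<longleftrightarrow> (\<forall>n\<ge>1. \<forall>a :: (nat \<Rightarrow> nat) \<Rightarrow> 'k.
     hpoly_coeff_norm (HL_exponent m p) m n a \<le> C * hpoly_sup_norm p m n a)"

lemma single_power_in_multi_indices: "(\<lambda>j. if j = 0 then m else 0) \<in> multi_indices m (Suc 0)"
  by (simp add: multi_indices_def)

lemma multi_indices_one: "multi_indices m (Suc 0) = {\<lambda>j. if j = 0 then m else 0}"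
proof -
  have "\<alpha> = (\<lambda>j. if j = 0 then m else 0)" if "\<alpha> \<in> multi_indices m (Suc 0)" for \<alpha>
    using that by (intro multi_indices_eqI[OF that single_power_in_multi_indices])
      (auto simp: multi_indices_def)
  then show ?thesis using single_power_in_multi_indices by blast
qed

text \<open>
  The admissible constants are bounded below, because the form \<open>z_0 ^ m\<close> in one variable forces
  \<open>C \<ge> 1\<close>, and they form a closed set, because each single inequality is linear in \<open>C\<close>. So the least
  one exists as soon as there is any.
\<close>

lemma H_pol_attained:
  fixes K :: "'k::real_normed_field itself"
  assumes "0 < s" and bnd: "HL_bound K m (ereal s) C"
  shows "HL_bound K m (ereal s) (H_pol K m (ereal s))" and "H_pol K m (ereal s) \<le> C"
proof -
  define X where "X = {C. HL_bound K m (ereal s) C}"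
  have ne: "X \<noteq> {}" using bnd by (auto simp: X_def)
  have lb: "1 \<le> C" if "C \<in> X" for C
  proof -
    let ?a = "(\<lambda>_. 1) :: (nat \<Rightarrow> nat) \<Rightarrow> 'k"
    have "hpoly_coeff_norm (HL_exponent m (ereal s)) m (Suc 0) ?a = 1"
      by (simp add: hpoly_coeff_norm_def multi_indices_one)
    moreover have "hpoly_sup_norm (ereal s) m (Suc 0) ?a \<le> 1"
    proof (rule hpoly_sup_norm_leI[OF assms(1)])
      fix z :: "nat \<Rightarrow> 'k" assume "lp_norm (ereal s) (Suc 0) z \<le> 1"
      then have "norm (z 0) \<le> 1" using lp_norm_le_oneD[OF assms(1)] by blast
      then show "norm (hpoly_eval m (Suc 0) ?a z) \<le> 1"
        by (simp add: hpoly_eval_def multi_indices_one norm_power power_le_one)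
    qed
    moreover have "0 \<le> hpoly_sup_norm (ereal s) m (Suc 0) ?a"
      using hpoly_sup_norm_nonneg assms(1) .
    moreover have "hpoly_coeff_norm (HL_exponent m (ereal s)) m (Suc 0) ?a
        \<le> C * hpoly_sup_norm (ereal s) m (Suc 0) ?a"
      using that by (auto simp: X_def HL_bound_def)
    ultimately show "1 \<le> C"
      by (smt (verit) mult_left_le mult_nonneg_nonneg mult_nonpos_nonneg mult_right_le_one_le)
  qed
  then have bdd: "bdd_below X" by (rule bdd_belowI)
  have "HL_bound K m (ereal s) (Inf X)"
    unfolding HL_bound_def
  proof (intro allI impI)
    fix n and a :: "(nat \<Rightarrow> nat) \<Rightarrow> 'k" assume n: "1 \<le> (n::nat)"
    let ?c = "hpoly_coeff_norm (HL_exponent m (ereal s)) m n a"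
    let ?s = "hpoly_sup_norm (ereal s) m n a"
    have le: "?c \<le> C * ?s" if "C \<in> X" for C
      using that n by (auto simp: X_def HL_bound_def)
    show "?c \<le> Inf X * ?s"
    proof (cases "?s = 0")
      case True
      then show ?thesis using le ne by fastforce
    next
      case False
      then have pos: "0 < ?s"
        using hpoly_sup_norm_nonneg[OF assms(1), of m n a] by linarith
      have "?c / ?s \<le> Inf X"
        using le pos by (intro cInf_greatest ne) (auto simp: field_simps)
      then show ?thesis using pos by (simp add: field_simps)
    qed
  qed
  moreover have "H_pol K m (ereal s) = (LEAST C. HL_bound K m (ereal s) C)"
    by (simp add: H_pol_def HL_bound_def)
  moreover have "(LEAST C. HL_bound K m (ereal s) C) = Inf X"
    using calculation(1) by (intro Least_equality cInf_lower bdd) (auto simp: X_def)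
  ultimately show "HL_bound K m (ereal s) (H_pol K m (ereal s))" "H_pol K m (ereal s) \<le> C"
    using bnd bdd by (auto simp: X_def intro: cInf_lower)
qed

section \<open>Averaging over rotations of the torus\<close>

abbreviation zpow :: "nat \<Rightarrow> (nat \<Rightarrow> 'k::comm_monoid_mult) \<Rightarrow> (nat \<Rightarrow> nat) \<Rightarrow> 'k" where
  "zpow n z \<alpha> \<equiv> \<Prod>j<n. z j ^ \<alpha> j"

definition unit_root :: "nat \<Rightarrow> complex" where
  "unit_root M = exp (2 * of_real pi * \<i> * of_nat 1 / of_nat M)"

lemma norm_unit_root [simp]: "norm (unit_root M) = 1"
  by (simp add: unit_root_def)

lemma unit_root_power_eq_1_iff:
  assumes "0 < M"
  shows "unit_root M ^ k = 1 \<longleftrightarrow> M dvd k"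
proof -
  have "unit_root M ^ k = exp (2 * of_real pi * \<i> * of_nat k / of_nat M)"
    unfolding unit_root_def by (subst exp_of_nat_mult[symmetric]) (simp add: field_simps)
  then show ?thesis using complex_root_unity_eq_1[of M k] assms by (simp add: mult_ac)
qed

lemma sum_unit_root_powers:
  assumes "0 < M"
  shows "(\<Sum>t<M. (unit_root M ^ t) ^ k) = (if M dvd k then of_nat M else 0)"
proof -
  have eq: "(\<Sum>t<M. (unit_root M ^ t) ^ k) = (\<Sum>t<M. (unit_root M ^ k) ^ t)"
    by (simp add: power_mult[symmetric] mult.commute)
  show ?thesis
  proof (cases "M dvd k")
    case True
    then have "unit_root M ^ k = 1" using unit_root_power_eq_1_iff[OF assms] by simp
    then show ?thesis unfolding eq using True by simp
  next
    case False
    have "(unit_root M ^ k) ^ M = 1"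
      using unit_root_power_eq_1_iff[OF assms, of "k * M"] by (simp add: power_mult)
    then show ?thesis
      using eq unit_root_power_eq_1_iff[OF assms, of k] False
      by (simp add: geometric_sum)
  qed
qed

text \<open>
  Orthogonality of the characters of a finite product of cyclic groups; it underlies both the
  projections in this section and the moment identities in the next.
\<close>

lemma sum_PiE_unit_root_powers:
  assumes "0 < M" "finite V"
  shows "(\<Sum>t\<in>PiE V (\<lambda>_. {..<M}). \<Prod>j\<in>V. (unit_root M ^ t j) ^ k j)
       = (if \<forall>j\<in>V. M dvd k j then of_nat M ^ card V else 0)"
proof -
  have "(\<Sum>t\<in>PiE V (\<lambda>_. {..<M}). \<Prod>j\<in>V. (unit_root M ^ t j) ^ k j)
      = (\<Prod>j\<in>V. \<Sum>t<M. (unit_root M ^ t) ^ k j)"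
    using assms(2) by (subst prod_sum_PiE) auto
  also have "\<dots> = (\<Prod>j\<in>V. if M dvd k j then of_nat M else 0)"
    by (simp add: sum_unit_root_powers[OF assms(1)])
  also have "\<dots> = (if \<forall>j\<in>V. M dvd k j then of_nat M ^ card V else 0)"
    using assms(2) by (auto intro: prod_zero)
  finally show ?thesis .
qed

definition torus :: "nat \<Rightarrow> (nat \<Rightarrow> complex) set" where
  "torus n = {z. \<forall>j<n. norm (z j) = 1}"

text \<open>
  A projection onto a set of monomials that is an average of rotations, with unimodular weights,
  does not increase the maximum on the torus. Here \<open>A\<close> is the set of monomials that survive.
\<close>

lemma torus_bound_multiplier:
  fixes b :: "(nat \<Rightarrow> nat) \<Rightarrow> complex"
  assumes bound: "\<And>z. z \<in> torus n \<Longrightarrow> norm (\<Sum>\<alpha>\<in>B. b \<alpha> * zpow n z \<alpha>) \<le> K"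
    and "finite B" "finite I" "I \<noteq> {}"
    and rot: "\<And>i. i \<in> I \<Longrightarrow> \<eta> i \<in> torus n" "\<And>i. i \<in> I \<Longrightarrow> norm (\<theta> i) = 1"
    and mult: "\<And>\<alpha>. \<alpha> \<in> B \<Longrightarrow>
      (\<Sum>i\<in>I. \<theta> i * zpow n (\<eta> i) \<alpha>) = (if \<alpha> \<in> A then of_nat (card I) else 0)"
    and z: "z \<in> torus n"
  shows "norm (\<Sum>\<alpha>\<in>B \<inter> A. b \<alpha> * zpow n z \<alpha>) \<le> K"
proof -
  have pos: "0 < card I" using assms(3,4) by (simp add: card_gt_0_iff)
  have "(\<Sum>i\<in>I. \<theta> i * (\<Sum>\<alpha>\<in>B. b \<alpha> * zpow n (\<lambda>j. \<eta> i j * z j) \<alpha>))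
      = (\<Sum>i\<in>I. \<Sum>\<alpha>\<in>B. b \<alpha> * zpow n z \<alpha> * (\<theta> i * zpow n (\<eta> i) \<alpha>))"
    by (simp add: sum_distrib_left power_mult_distrib prod.distrib mult_ac)
  also have "\<dots> = (\<Sum>\<alpha>\<in>B. b \<alpha> * zpow n z \<alpha> * (\<Sum>i\<in>I. \<theta> i * zpow n (\<eta> i) \<alpha>))"
    by (subst sum.swap) (simp add: sum_distrib_left)
  also have "\<dots> = (\<Sum>\<alpha>\<in>B. if \<alpha> \<in> A then b \<alpha> * zpow n z \<alpha> * of_nat (card I) else 0)"
    using mult by (intro sum.cong) auto
  also have "\<dots> = of_nat (card I) * (\<Sum>\<alpha>\<in>B \<inter> A. b \<alpha> * zpow n z \<alpha>)"
    using assms(2) by (simp add: sum.If_cases sum_distrib_left mult_ac Collect_mem_eq)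
  finally have eq: "of_nat (card I) * (\<Sum>\<alpha>\<in>B \<inter> A. b \<alpha> * zpow n z \<alpha>)
      = (\<Sum>i\<in>I. \<theta> i * (\<Sum>\<alpha>\<in>B. b \<alpha> * zpow n (\<lambda>j. \<eta> i j * z j) \<alpha>))" ..
  have "real (card I) * norm (\<Sum>\<alpha>\<in>B \<inter> A. b \<alpha> * zpow n z \<alpha>)
      = norm (of_nat (card I) * (\<Sum>\<alpha>\<in>B \<inter> A. b \<alpha> * zpow n z \<alpha>))"
    by (simp add: norm_mult)
  also have "\<dots> \<le> (\<Sum>i\<in>I. K)"
    unfolding eq
  proof (rule sum_norm_le)
    fix i assume i: "i \<in> I"
    have "(\<lambda>j. \<eta> i j * z j) \<in> torus n"
      using rot(1)[OF i] z by (auto simp: torus_def norm_mult)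
    from bound[OF this]
    show "norm (\<theta> i * (\<Sum>\<alpha>\<in>B. b \<alpha> * zpow n (\<lambda>j. \<eta> i j * z j) \<alpha>)) \<le> K"
      using rot(2)[OF i] by (simp add: norm_mult)
  qed
  finally show ?thesis using pos by simp
qed

lemma prod_if_subset:
  fixes f :: "nat \<Rightarrow> 'k::comm_monoid_mult"
  assumes "V \<subseteq> {..<n}"
  shows "(\<Prod>j<n. (if j \<in> V then f j else 1) ^ \<alpha> j) = (\<Prod>j\<in>V. f j ^ \<alpha> j)"
  by (rule prod.mono_neutral_cong_right) (use assms in auto)

text \<open>
  The average over simultaneous rotations of the variables in \<open>V\<close> by roots of unity of order \<open>m + 1\<close>.
  This order is large enough to tell the degrees \<open>0, \<dots>, m\<close> apart.
\<close>

lemma torus_bound_block_degree: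
  assumes bound: "\<And>z. z \<in> torus n \<Longrightarrow> norm (\<Sum>\<alpha>\<in>multi_indices m n. b \<alpha> * zpow n z \<alpha>) \<le> K"
    and V: "V \<subseteq> {..<n}" and "d \<le> m" and z: "z \<in> torus n"
  shows "norm (\<Sum>\<alpha>\<in>multi_indices m n \<inter> {\<alpha>. (\<Sum>j\<in>V. \<alpha> j) = d}. b \<alpha> * zpow n z \<alpha>) \<le> K"
proof (rule torus_bound_multiplier[where I = "{..<Suc m}"
    and \<eta> = "\<lambda>t j. if j \<in> V then unit_root (Suc m) ^ t else 1"
    and \<theta> = "\<lambda>t. (unit_root (Suc m) ^ t) ^ (Suc m - d)", OF bound])
  fix \<alpha> assume \<alpha>: "\<alpha> \<in> multi_indices m n"
  let ?s = "\<Sum>j\<in>V. \<alpha> j"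
  have s: "?s \<le> m"
    using sum_mono2[OF _ V, of \<alpha>] sum_multi_index[OF \<alpha>] by simp
  \<comment> \<open>\<open>Suc m - d\<close> represents \<open>- d\<close> modulo \<open>Suc m\<close>\<close>
  have "Suc m dvd ?s + (Suc m - d) \<longleftrightarrow> ?s = d"
  proof
    assume dv: "Suc m dvd ?s + (Suc m - d)"
    have pos: "0 < ?s + (Suc m - d)" "?s + (Suc m - d) < 2 * Suc m"
      using s assms(3) by auto
    obtain c where c: "?s + (Suc m - d) = Suc m * c" using dv by (auto simp: dvd_def)
    have "c \<noteq> 0" using c pos by (intro notI) simp
    moreover have "c < 2" using c pos(2) by (metis mult.commute mult_less_cancel1)
    ultimately have "c = 1" by simp
    then show "?s = d" using c assms(3) by simp
  qed (use assms(3) in simp)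
  moreover have "(\<Sum>t<Suc m. (unit_root (Suc m) ^ t) ^ (Suc m - d)
        * zpow n (\<lambda>j. if j \<in> V then unit_root (Suc m) ^ t else 1) \<alpha>)
      = (\<Sum>t<Suc m. (unit_root (Suc m) ^ t) ^ (?s + (Suc m - d)))"
    unfolding prod_if_subset[OF V] power_sum[symmetric] power_add by (simp only: mult.commute)
  ultimately show "(\<Sum>t<Suc m. (unit_root (Suc m) ^ t) ^ (Suc m - d)
        * zpow n (\<lambda>j. if j \<in> V then unit_root (Suc m) ^ t else 1) \<alpha>)
      = (if \<alpha> \<in> {\<alpha>. (\<Sum>j\<in>V. \<alpha> j) = d} then of_nat (card {..<Suc m}) else 0)"
    by (simp only: sum_unit_root_powers[OF zero_less_Suc] mem_Collect_eq card_lessThan)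
qed (use z in \<open>auto simp: torus_def norm_power\<close>)

text \<open>
  The average over independent rotations of the variables in \<open>V\<close> by roots of unity of order \<open>d\<close>.
\<close>

lemma torus_bound_block_dvd:
  assumes bound: "\<And>z. z \<in> torus n \<Longrightarrow> norm (\<Sum>\<alpha>\<in>B. b \<alpha> * zpow n z \<alpha>) \<le> K"
    and V: "V \<subseteq> {..<n}" and "0 < d" "finite B" and z: "z \<in> torus n"
  shows "norm (\<Sum>\<alpha>\<in>B \<inter> {\<alpha>. \<forall>j\<in>V. d dvd \<alpha> j}. b \<alpha> * zpow n z \<alpha>) \<le> K"
proof -
  have fV: "finite V" using V finite_subset by blast
  show ?thesis
  proof (rule torus_bound_multiplier[where I = "PiE V (\<lambda>_. {..<d})"
      and \<eta> = "\<lambda>t j. if j \<in> V then unit_root d ^ t j else 1" and \<theta> = "\<lambda>_. 1", OF bound])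
    show "finite (PiE V (\<lambda>_. {..<d}))" using fV by (simp add: finite_PiE)
    show "PiE V (\<lambda>_. {..<d}) \<noteq> {}" using assms(3) by (auto simp: PiE_eq_empty_iff)
    fix \<alpha> assume "\<alpha> \<in> B"
    show "(\<Sum>t\<in>PiE V (\<lambda>_. {..<d}). 1 * zpow n (\<lambda>j. if j \<in> V then unit_root d ^ t j else 1) \<alpha>)
      = (if \<alpha> \<in> {\<alpha>. \<forall>j\<in>V. d dvd \<alpha> j} then of_nat (card (PiE V (\<lambda>_. {..<d}))) else 0)"
      unfolding prod_if_subset[OF V] mult_1
      by (subst sum_PiE_unit_root_powers[OF assms(3) fV]) (simp add: card_PiE fV)
  qed (use assms z in \<open>auto simp: torus_def norm_power\<close>)
qed

definition block_slice :: "nat \<Rightarrow> nat \<Rightarrow> nat set \<Rightarrow> nat \<Rightarrow> nat \<Rightarrow> (nat \<Rightarrow> nat) set" where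
  "block_slice m n V d j = {\<alpha> \<in> multi_indices m n. \<alpha> j = d \<and> (\<forall>i\<in>V - {j}. \<alpha> i = 0)}"

lemma finite_block_slice [simp]: "finite (block_slice m n V d j)"
  by (simp add: block_slice_def)

text \<open>
  If all exponents in \<open>V\<close> are multiples of \<open>d\<close> and add up to \<open>d\<close>, only one of them can be nonzero.
  Hence the two projections above, applied in succession, leave exactly the slices.
\<close>

lemma block_slice_Union:
  assumes "finite V" "0 < d"
  shows "multi_indices m n \<inter> {\<alpha>. (\<Sum>j\<in>V. \<alpha> j) = d} \<inter> {\<alpha>. \<forall>j\<in>V. d dvd \<alpha> j}
      = (\<Union>j\<in>V. block_slice m n V d j)" (is "?L = ?R")
proof
  show "?L \<subseteq> ?R"
  proof
    fix \<alpha> assume "\<alpha> \<in> ?L"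
    then have \<alpha>: "\<alpha> \<in> multi_indices m n" "(\<Sum>j\<in>V. \<alpha> j) = d" "\<forall>j\<in>V. d dvd \<alpha> j" by auto
    then obtain j where j: "j \<in> V" "\<alpha> j \<noteq> 0"
      using assms(2) by (metis not_gr_zero sum.neutral)
    then have "d \<le> \<alpha> j" using \<alpha>(3) by (simp add: dvd_imp_le)
    moreover have "\<alpha> j + (\<Sum>i\<in>V - {j}. \<alpha> i) = d" using \<alpha>(2) j(1) assms(1) by (simp add: sum.remove)
    ultimately have "\<alpha> j = d" "(\<Sum>i\<in>V - {j}. \<alpha> i) = 0" by auto
    then show "\<alpha> \<in> ?R" using j(1) \<alpha>(1) assms(1) by (auto simp: block_slice_def)
  qed
  show "?R \<subseteq> ?L"
  proof
    fix \<alpha> assume "\<alpha> \<in> ?R"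
    then obtain j where j: "j \<in> V" "\<alpha> \<in> block_slice m n V d j" by auto
    then have "(\<Sum>i\<in>V - {j}. \<alpha> i) = 0" by (auto simp: block_slice_def)
    then have "(\<Sum>i\<in>V. \<alpha> i) = d"
      using j assms(1) by (simp add: block_slice_def sum.remove)
    then show "\<alpha> \<in> ?L" using j by (auto simp: block_slice_def) (metis DiffI dvd_0_right dvd_refl singletonD)
  qed
qed

lemma block_slice_disjoint:
  assumes "0 < d" "i \<in> V" "j \<in> V" "i \<noteq> j"
  shows "block_slice m n V d i \<inter> block_slice m n V d j = {}"
  using assms by (auto simp: block_slice_def)

text \<open>
  After the projection onto the slices of \<open>V\<close> the form is \<open>\<Sum>_{j \<in> V} z_j ^ d * c_j\<close>, where \<open>c_j\<close> does
  not involve the variables of \<open>V\<close>. The phases of the \<open>z_j\<close> can therefore be chosen so that all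
  summands become nonnegative.
\<close>

lemma torus_bound_aligned:
  assumes bound: "\<And>z. z \<in> torus n \<Longrightarrow> norm (\<Sum>\<alpha>\<in>multi_indices m n. b \<alpha> * zpow n z \<alpha>) \<le> K"
    and V: "V \<subseteq> {..<n}" and d: "0 < d" "d \<le> m" and z: "z \<in> torus n"
  shows "(\<Sum>j\<in>V. norm (\<Sum>\<alpha>\<in>block_slice m n V d j. b \<alpha> * zpow n z \<alpha>)) \<le> K"
proof -
  have fV: "finite V" using V finite_subset by blast
  define c where "c j = (\<Sum>\<alpha>\<in>block_slice m n V d j. b \<alpha> * zpow n z \<alpha>)" for j
  have "\<exists>u. norm u = 1 \<and> u ^ d * w = of_real (norm w)" for w :: complex
  proof -
    have w: "w = of_real (norm w) * cis (Arg w)" by (simp add: rcis_cmod_Arg flip: rcis_def)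
    have "cis (- Arg w / d) ^ d = cis (- Arg w)" using d by (simp add: Complex.DeMoivre)
    then have "cis (- Arg w / d) ^ d * w = of_real (norm w) * (cis (- Arg w) * cis (Arg w))"
      using w by (metis mult.commute mult.left_commute)
    also have "\<dots> = of_real (norm w)" by (simp add: cis_mult)
    finally show ?thesis by (intro exI[of _ "cis (- Arg w / d)"]) simp
  qed
  then have "\<forall>j. \<exists>u. norm u = 1 \<and> u ^ d * c j = of_real (norm (c j))" by blast
  then obtain u where u: "\<And>j. norm (u j) = 1" "\<And>j. u j ^ d * c j = of_real (norm (c j))"
    using choice[of "\<lambda>j u. norm u = 1 \<and> u ^ d * c j = of_real (norm (c j))"] by blast
  define z' where "z' j = (if j \<in> V then u j else 1) * z j" for j
  have z': "z' \<in> torus n" using z u(1) by (auto simp: z'_def torus_def norm_mult)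
  have slice: "zpow n z' \<alpha> = u j ^ d * zpow n z \<alpha>" if "j \<in> V" "\<alpha> \<in> block_slice m n V d j" for j \<alpha>
  proof -
    have "zpow n z' \<alpha> = (\<Prod>i\<in>V. u i ^ \<alpha> i) * zpow n z \<alpha>"
      unfolding z'_def power_mult_distrib prod.distrib prod_if_subset[OF V] ..
    also have "(\<Prod>i\<in>V. u i ^ \<alpha> i) = u j ^ \<alpha> j * (\<Prod>i\<in>V - {j}. u i ^ \<alpha> i)"
      using that(1) fV by (rule prod.remove[rotated])
    also have "(\<Prod>i\<in>V - {j}. u i ^ \<alpha> i) = 1"
      using that(2) by (intro prod.neutral) (auto simp: block_slice_def)
    finally show ?thesis using that(2) by (simp add: block_slice_def)
  qed
  have "(\<Sum>\<alpha>\<in>(\<Union>j\<in>V. block_slice m n V d j). b \<alpha> * zpow n z' \<alpha>)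
      = (\<Sum>j\<in>V. \<Sum>\<alpha>\<in>block_slice m n V d j. b \<alpha> * zpow n z' \<alpha>)"
    using fV block_slice_disjoint[OF d(1)] by (intro sum.UNION_disjoint) auto
  also have "\<dots> = (\<Sum>j\<in>V. u j ^ d * c j)"
    using slice by (intro sum.cong refl) (simp add: c_def sum_distrib_left mult_ac)
  also have "\<dots> = of_real (\<Sum>j\<in>V. norm (c j))" by (simp add: u(2))
  finally have eq: "(\<Sum>\<alpha>\<in>(\<Union>j\<in>V. block_slice m n V d j). b \<alpha> * zpow n z' \<alpha>)
      = of_real (\<Sum>j\<in>V. norm (c j))" .
  have "norm (\<Sum>\<alpha>\<in>(\<Union>j\<in>V. block_slice m n V d j). b \<alpha> * zpow n z' \<alpha>) \<le> K"
    unfolding block_slice_Union[OF fV d(1), symmetric]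
    using torus_bound_block_dvd[OF torus_bound_block_degree[OF bound V d(2)] V d(1) _ z'] by simp
  then have "\<bar>\<Sum>j\<in>V. norm (c j)\<bar> \<le> K" unfolding eq norm_of_real .
  then show ?thesis by (simp add: c_def)
qed

section \<open>Moments over a grid of roots of unity\<close>

text \<open>
  Averages over the points of the torus with coordinates that are roots of unity of order \<open>M\<close> replace integrals over the torus:
  for forms of degree below \<open>M\<close> they give the same second moments.
\<close>

definition grid :: "nat \<Rightarrow> nat \<Rightarrow> (nat \<Rightarrow> nat) set" where
  "grid n M = PiE {..<n} (\<lambda>_. {..<M})"

definition grid_point :: "nat \<Rightarrow> (nat \<Rightarrow> nat) \<Rightarrow> nat \<Rightarrow> complex" where
  "grid_point M t j = unit_root M ^ t j"

lemma finite_grid [simp]: "finite (grid n M)"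
  by (simp add: grid_def finite_PiE)

lemma card_grid [simp]: "card (grid n M) = M ^ n"
  by (simp add: grid_def card_PiE)

lemma grid_point_torus [simp]: "grid_point M t \<in> torus n"
  by (simp add: torus_def grid_point_def norm_power)

lemma cnj_unit_root: "0 < M \<Longrightarrow> cnj (unit_root M) = unit_root M ^ (M - 1)"
proof -
  assume M: "0 < M"
  have "unit_root M * unit_root M ^ (M - 1) = 1"
    using M unit_root_power_eq_1_iff[OF M, of M] by (metis dvd_refl power_eq_if not_gr_zero)
  moreover have "unit_root M * cnj (unit_root M) = 1"
    by (simp add: complex_norm_square[symmetric])
  ultimately show ?thesis by (metis mult_cancel_left mult_eq_0_iff zero_neq_one)
qed

lemma grid_orthogonality:
  assumes \<alpha>: "\<alpha> \<in> multi_indices m n" and \<beta>: "\<beta> \<in> multi_indices m n" and M: "m < M"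
  shows "(\<Sum>t\<in>grid n M. zpow n (grid_point M t) \<alpha> * cnj (zpow n (grid_point M t) \<beta>))
       = (if \<alpha> = \<beta> then of_nat (M ^ n) else 0)"
proof -
  have M0: "0 < M" using M by simp
  have "(\<Sum>t\<in>grid n M. zpow n (grid_point M t) \<alpha> * cnj (zpow n (grid_point M t) \<beta>))
      = (\<Sum>t\<in>PiE {..<n} (\<lambda>_. {..<M}). \<Prod>j<n. (unit_root M ^ t j) ^ (\<alpha> j + (M - 1) * \<beta> j))"
    unfolding grid_def grid_point_def
    by (intro sum.cong refl)
      (simp add: prod.distrib[symmetric] cnj_unit_root[OF M0] power_add power_mult[symmetric] mult_ac)
  also have "\<dots> = (if \<forall>j\<in>{..<n}. M dvd \<alpha> j + (M - 1) * \<beta> j then of_nat M ^ n else 0)"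
    by (subst sum_PiE_unit_root_powers[OF M0]) simp_all
  also have "(\<forall>j\<in>{..<n}. M dvd \<alpha> j + (M - 1) * \<beta> j) \<longleftrightarrow> \<alpha> = \<beta>"
  proof -
    have "M dvd \<alpha> j + (M - 1) * \<beta> j \<longleftrightarrow> \<alpha> j = \<beta> j" for j
    proof -
      have lt: "\<alpha> j < M" "\<beta> j < M" using multi_indices_le[OF \<alpha>] multi_indices_le[OF \<beta>] M
        by (meson le_less_trans)+
      have "\<alpha> j + (M - 1) * \<beta> j + \<beta> j = \<alpha> j + M * \<beta> j"
        using M0 by (cases M) auto
      then have *: "(\<alpha> j + (M - 1) * \<beta> j + \<beta> j) mod M = \<alpha> j"
        using lt by (simp only: mod_mult_self2 mod_less)
      show ?thesis
      proof
        assume "M dvd \<alpha> j + (M - 1) * \<beta> j"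
        then have "(\<alpha> j + (M - 1) * \<beta> j + \<beta> j) mod M = \<beta> j"
          using lt by (auto simp: dvd_def)
        then show "\<alpha> j = \<beta> j" using * by simp
      next
        assume "\<alpha> j = \<beta> j"
        then have "\<alpha> j + (M - 1) * \<beta> j = M * \<beta> j" using M0 by (cases M) auto
        then show "M dvd \<alpha> j + (M - 1) * \<beta> j" by simp
      qed
    qed
    then show ?thesis using multi_indices_eqI[OF \<alpha> \<beta>] by auto
  qed
  finally show ?thesis by simp
qed

lemma grid_parseval:
  fixes b :: "(nat \<Rightarrow> nat) \<Rightarrow> complex"
  assumes B: "B \<subseteq> multi_indices m n" and M: "m < M"
  shows "(\<Sum>t\<in>grid n M. norm (\<Sum>\<alpha>\<in>B. b \<alpha> * zpow n (grid_point M t) \<alpha>) ^ 2)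
       = real (M ^ n) * (\<Sum>\<alpha>\<in>B. norm (b \<alpha>) ^ 2)"
proof -
  have fB: "finite B" using B finite_subset by blast
  let ?z = "\<lambda>t. zpow n (grid_point M t)"
  have "complex_of_real (\<Sum>t\<in>grid n M. norm (\<Sum>\<alpha>\<in>B. b \<alpha> * ?z t \<alpha>) ^ 2)
      = (\<Sum>t\<in>grid n M. (\<Sum>\<alpha>\<in>B. b \<alpha> * ?z t \<alpha>) * cnj (\<Sum>\<beta>\<in>B. b \<beta> * ?z t \<beta>))"
    by (simp only: of_real_sum complex_norm_square)
  also have "\<dots> = (\<Sum>t\<in>grid n M. \<Sum>\<alpha>\<in>B. \<Sum>\<beta>\<in>B. b \<alpha> * cnj (b \<beta>) * (?z t \<alpha> * cnj (?z t \<beta>)))"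
    by (simp only: cnj_sum complex_cnj_mult sum_product mult_ac)
  also have "\<dots> = (\<Sum>\<alpha>\<in>B. \<Sum>\<beta>\<in>B. b \<alpha> * cnj (b \<beta>) * (\<Sum>t\<in>grid n M. ?z t \<alpha> * cnj (?z t \<beta>)))"
    by (subst sum.swap, rule sum.cong[OF refl], subst sum.swap) (simp only: sum_distrib_left)
  also have "\<dots> = (\<Sum>\<alpha>\<in>B. \<Sum>\<beta>\<in>B. if \<alpha> = \<beta> then b \<alpha> * cnj (b \<beta>) * of_nat (M ^ n) else 0)"
  proof (intro sum.cong refl)
    fix \<alpha> \<beta> assume "\<alpha> \<in> B" "\<beta> \<in> B"
    then have "(\<Sum>t\<in>grid n M. ?z t \<alpha> * cnj (?z t \<beta>)) = (if \<alpha> = \<beta> then of_nat (M ^ n) else 0)"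
      using B M by (intro grid_orthogonality) auto
    then show "b \<alpha> * cnj (b \<beta>) * (\<Sum>t\<in>grid n M. ?z t \<alpha> * cnj (?z t \<beta>))
        = (if \<alpha> = \<beta> then b \<alpha> * cnj (b \<beta>) * of_nat (M ^ n) else 0)" by simp
  qed
  also have "\<dots> = (\<Sum>\<alpha>\<in>B. b \<alpha> * cnj (b \<alpha>) * of_nat (M ^ n))"
    using fB by (simp add: sum.delta)
  also have "\<dots> = complex_of_real (real (M ^ n) * (\<Sum>\<alpha>\<in>B. norm (b \<alpha>) ^ 2))"
    by (simp only: of_real_mult of_real_sum complex_norm_square sum_distrib_left of_real_of_nat_eq mult_ac)
  finally show ?thesis by (simp only: of_real_eq_iff)
qed

text \<open>
  The Cauchy estimate of a coefficient by the mean modulus: pair the form with the conjugate of the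
  monomial.
\<close>

lemma grid_coefficient_bound:
  fixes b :: "(nat \<Rightarrow> nat) \<Rightarrow> complex"
  assumes B: "B \<subseteq> multi_indices m n" and M: "m < M" and \<beta>: "\<beta> \<in> B"
  shows "real (M ^ n) * norm (b \<beta>) \<le> (\<Sum>t\<in>grid n M. norm (\<Sum>\<alpha>\<in>B. b \<alpha> * zpow n (grid_point M t) \<alpha>))"
proof -
  have fB: "finite B" using B finite_subset by blast
  let ?z = "\<lambda>t. zpow n (grid_point M t)"
  have "(\<Sum>t\<in>grid n M. (\<Sum>\<alpha>\<in>B. b \<alpha> * ?z t \<alpha>) * cnj (?z t \<beta>))
      = (\<Sum>\<alpha>\<in>B. b \<alpha> * (\<Sum>t\<in>grid n M. ?z t \<alpha> * cnj (?z t \<beta>)))"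
    unfolding sum_distrib_right sum_distrib_left by (subst sum.swap) (simp only: mult_ac)
  also have "\<dots> = (\<Sum>\<alpha>\<in>B. if \<alpha> = \<beta> then b \<alpha> * of_nat (M ^ n) else 0)"
  proof (intro sum.cong refl)
    fix \<alpha> assume "\<alpha> \<in> B"
    then have "(\<Sum>t\<in>grid n M. ?z t \<alpha> * cnj (?z t \<beta>)) = (if \<alpha> = \<beta> then of_nat (M ^ n) else 0)"
      using B M \<beta> by (intro grid_orthogonality) auto
    then show "b \<alpha> * (\<Sum>t\<in>grid n M. ?z t \<alpha> * cnj (?z t \<beta>))
        = (if \<alpha> = \<beta> then b \<alpha> * of_nat (M ^ n) else 0)" by simp
  qed
  also have "\<dots> = b \<beta> * of_nat (M ^ n)" using fB \<beta> by (simp add: sum.delta)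
  finally have eq: "b \<beta> * of_nat (M ^ n)
      = (\<Sum>t\<in>grid n M. (\<Sum>\<alpha>\<in>B. b \<alpha> * ?z t \<alpha>) * cnj (?z t \<beta>))" ..
  have "real (M ^ n) * norm (b \<beta>) = norm (b \<beta> * of_nat (M ^ n))"
    by (simp only: norm_mult norm_of_nat mult.commute)
  also have "\<dots> \<le> (\<Sum>t\<in>grid n M. norm (\<Sum>\<alpha>\<in>B. b \<alpha> * ?z t \<alpha>))"
    unfolding eq
  proof (rule sum_norm_le)
    fix t
    have "norm (?z t \<beta>) = 1"
      using grid_point_torus[of M t n] by (simp add: torus_def prod_norm[symmetric] norm_power)
    then show "norm ((\<Sum>\<alpha>\<in>B. b \<alpha> * ?z t \<alpha>) * cnj (?z t \<beta>)) \<le> norm (\<Sum>\<alpha>\<in>B. b \<alpha> * ?z t \<alpha>)"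
      by (simp only: norm_mult complex_mod_cnj mult_1_right order_refl)
  qed
  finally show ?thesis .
qed

text \<open>
  In a decomposition \<open>\<gamma> = \<alpha> + \<beta>\<close> the summand \<open>\<alpha>\<close> lies below \<open>\<gamma>\<close>, and there are
  \<open>\<Prod> (\<gamma> j + 1) \<le> \<Prod> 2 ^ \<gamma> j\<close> multi-indices below \<open>\<gamma>\<close>.
\<close>

lemma card_decompositions_le:
  assumes \<gamma>: "\<gamma> \<in> multi_indices (2 * m) n" and B: "B \<subseteq> multi_indices m n"
  shows "card {x\<in>B \<times> B. (\<lambda>j. fst x j + snd x j) = \<gamma>} \<le> 4 ^ m"
proof -
  let ?X = "{x\<in>B \<times> B. (\<lambda>j. fst x j + snd x j) = \<gamma>}"
  let ?f = "\<lambda>x. restrict (fst x) {..<n} :: nat \<Rightarrow> nat"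
  let ?Y = "PiE {..<n} (\<lambda>j. {..\<gamma> j})"
  have "inj_on ?f ?X"
  proof (rule inj_onI)
    fix x y assume x: "x \<in> ?X" and y: "y \<in> ?X" and eq: "?f x = ?f y"
    have fst: "fst x = fst y"
    proof (rule multi_indices_eqI)
      show "fst x \<in> multi_indices m n" "fst y \<in> multi_indices m n" using x y B by auto
      show "fst x j = fst y j" if "j < n" for j
        using fun_cong[OF eq, of j] that by simp
    qed
    have "(\<lambda>j. fst x j + snd x j) = (\<lambda>j. fst y j + snd y j)" using x y by auto
    from fun_cong[OF this] have "snd x = snd y" using fst by (intro ext) simp
    then show "x = y" using fst by (simp add: prod_eq_iff)
  qed
  moreover have "?f ` ?X \<subseteq> ?Y"
  proof (rule image_subsetI)
    fix x assume "x \<in> ?X"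
    then have "(\<lambda>j. fst x j + snd x j) = \<gamma>" by simp
    from fun_cong[OF this] have "fst x j \<le> \<gamma> j" for j by (metis le_add1)
    then show "?f x \<in> ?Y" by auto
  qed
  ultimately have "card ?X \<le> card ?Y" by (intro card_inj_on_le) (auto simp: finite_PiE)
  also have "card ?Y = (\<Prod>j<n. Suc (\<gamma> j))" by (simp add: card_PiE)
  also have "\<dots> \<le> (\<Prod>j<n. 2 ^ \<gamma> j)"
    by (intro prod_mono) (auto simp: Suc_le_eq)
  also have "\<dots> = 4 ^ m"
    using sum_multi_index[OF \<gamma>] by (simp add: power_sum[symmetric] power_mult)
  finally show ?thesis .
qed

lemma norm_sum_power2_le:
  fixes f :: "'a \<Rightarrow> complex"
  assumes "finite S"
  shows "norm (sum f S) ^ 2 \<le> real (card S) * (\<Sum>x\<in>S. norm (f x) ^ 2)"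
proof -
  have "norm (sum f S) ^ 2 \<le> (\<Sum>x\<in>S. norm (f x)) ^ 2"
    by (intro power_mono norm_sum) auto
  also have "\<dots> \<le> real (card S) * (\<Sum>x\<in>S. norm (f x) ^ 2)"
    using sum_squared_le_sum_of_squares[of "\<lambda>x. norm (f x)" S] by (simp add: mult.commute)
  finally show ?thesis .
qed

text \<open>
  The fourth moment of a form is the second moment of its square. Each coefficient of the square is
  a sum of at most \<open>4 ^ m\<close> products, so the Cauchy--Schwarz inequality loses at most this factor.
\<close>

lemma grid_fourth_moment:
  fixes b :: "(nat \<Rightarrow> nat) \<Rightarrow> complex"
  assumes B: "B \<subseteq> multi_indices m n" and M: "2 * m < M"
  shows "(\<Sum>t\<in>grid n M. norm (\<Sum>\<alpha>\<in>B. b \<alpha> * zpow n (grid_point M t) \<alpha>) ^ 4)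
       \<le> real (M ^ n) * 4 ^ m * (\<Sum>\<alpha>\<in>B. norm (b \<alpha>) ^ 2) ^ 2"
proof -
  have fB: "finite B" using B finite_subset by blast
  let ?add = "\<lambda>x j. fst x j + snd x j :: nat"
  let ?D = "\<lambda>\<gamma>. {x\<in>B \<times> B. ?add x = \<gamma>}"
  define e where "e \<gamma> = (\<Sum>x\<in>?D \<gamma>. b (fst x) * b (snd x))" for \<gamma>
  have add: "?add x \<in> multi_indices (2 * m) n" if "x \<in> B \<times> B" for x
  proof -
    have "fst x \<in> multi_indices m n" "snd x \<in> multi_indices m n" using that B by auto
    then show ?thesis by (simp add: multi_indices_def sum.distrib)
  qed
  have sq: "(\<Sum>\<alpha>\<in>B. b \<alpha> * zpow n z \<alpha>) ^ 2 = (\<Sum>\<gamma>\<in>multi_indices (2 * m) n. e \<gamma> * zpow n z \<gamma>)" for z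
  proof -
    have "(\<Sum>\<alpha>\<in>B. b \<alpha> * zpow n z \<alpha>) ^ 2
        = (\<Sum>x\<in>B \<times> B. (b (fst x) * b (snd x)) * zpow n z (?add x))"
      unfolding power2_eq_square sum_product sum.cartesian_product
      by (intro sum.cong refl) (auto simp: power_add prod.distrib mult_ac)
    also have "\<dots> = hpoly_eval (2 * m) n e z"
      unfolding e_def using fB add by (intro sum_monomials_eq_hpoly_eval) auto
    finally show ?thesis by (simp add: hpoly_eval_def)
  qed
  have "(\<Sum>t\<in>grid n M. norm (\<Sum>\<alpha>\<in>B. b \<alpha> * zpow n (grid_point M t) \<alpha>) ^ 4)
      = (\<Sum>t\<in>grid n M. norm ((\<Sum>\<alpha>\<in>B. b \<alpha> * zpow n (grid_point M t) \<alpha>) ^ 2) ^ 2)"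
    by (simp add: norm_power power_mult[symmetric])
  also have "\<dots> = real (M ^ n) * (\<Sum>\<gamma>\<in>multi_indices (2 * m) n. norm (e \<gamma>) ^ 2)"
    unfolding sq by (rule grid_parseval[OF order_refl M])
  also have "\<dots> \<le> real (M ^ n) * (\<Sum>\<gamma>\<in>multi_indices (2 * m) n.
      4 ^ m * (\<Sum>x\<in>?D \<gamma>. norm (b (fst x)) ^ 2 * norm (b (snd x)) ^ 2))"
  proof (intro mult_left_mono sum_mono)
    fix \<gamma> assume \<gamma>: "\<gamma> \<in> multi_indices (2 * m) n"
    have "real (card (?D \<gamma>)) \<le> real (4 ^ m)"
      using card_decompositions_le[OF \<gamma> B] of_nat_le_iff by blast
    then have card: "real (card (?D \<gamma>)) \<le> 4 ^ m" by simp
    have "norm (e \<gamma>) ^ 2 \<le> real (card (?D \<gamma>)) * (\<Sum>x\<in>?D \<gamma>. norm (b (fst x) * b (snd x)) ^ 2)"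
      unfolding e_def using fB by (intro norm_sum_power2_le) auto
    also have "\<dots> \<le> 4 ^ m * (\<Sum>x\<in>?D \<gamma>. norm (b (fst x) * b (snd x)) ^ 2)"
      using card by (intro mult_right_mono sum_nonneg) auto
    finally show "norm (e \<gamma>) ^ 2 \<le> 4 ^ m * (\<Sum>x\<in>?D \<gamma>. norm (b (fst x)) ^ 2 * norm (b (snd x)) ^ 2)"
      by (simp add: norm_mult power_mult_distrib)
  qed simp
  also have "(\<Sum>\<gamma>\<in>multi_indices (2 * m) n.
      4 ^ m * (\<Sum>x\<in>?D \<gamma>. norm (b (fst x)) ^ 2 * norm (b (snd x)) ^ 2))
      = 4 ^ m * (\<Sum>x\<in>B \<times> B. norm (b (fst x)) ^ 2 * norm (b (snd x)) ^ 2)"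
    unfolding sum_distrib_left[symmetric]
    using fB add by (subst sum.group) auto
  also have "(\<Sum>x\<in>B \<times> B. norm (b (fst x)) ^ 2 * norm (b (snd x)) ^ 2) = (\<Sum>\<alpha>\<in>B. norm (b \<alpha>) ^ 2) ^ 2"
    unfolding power2_eq_square[of "sum _ _"] sum_product sum.cartesian_product
    by (intro sum.cong refl) auto
  finally show ?thesis by (simp add: mult.assoc)
qed

text \<open>
  A comparison of the second moment with the first, via the fourth. The inequality
  \<open>x ^ 2 \<le> l * x + x ^ 4 / l ^ 2\<close> takes the place of the Hoelder interpolation between the three; the
  threshold \<open>l\<close> is chosen so that the last term absorbs half of the second moment.
\<close>

lemma grid_l2_le_l1:
  fixes b :: "(nat \<Rightarrow> nat) \<Rightarrow> complex"
  assumes B: "B \<subseteq> multi_indices m n" and M: "2 * m < M"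
  defines "E \<equiv> (\<Sum>t\<in>grid n M. norm (\<Sum>\<alpha>\<in>B. b \<alpha> * zpow n (grid_point M t) \<alpha>)) / real (M ^ n)"
  shows "(\<Sum>\<alpha>\<in>B. norm (b \<alpha>) ^ 2) \<le> 8 * 4 ^ m * E ^ 2"
proof -
  define S where "S = (\<Sum>\<alpha>\<in>B. norm (b \<alpha>) ^ 2)"
  define N where "N = real (M ^ n)"
  define F where "F t = norm (\<Sum>\<alpha>\<in>B. b \<alpha> * zpow n (grid_point M t) \<alpha>)" for t
  have N: "0 < N" using M by (simp add: N_def)
  have E: "(\<Sum>t\<in>grid n M. F t) = N * E" "0 \<le> E"
    using N by (auto simp: E_def F_def N_def intro!: divide_nonneg_nonneg sum_nonneg)
  have F2: "(\<Sum>t\<in>grid n M. F t ^ 2) = N * S"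
    unfolding F_def N_def S_def using M by (intro grid_parseval[OF B]) auto
  have F4: "(\<Sum>t\<in>grid n M. F t ^ 4) \<le> N * 4 ^ m * S ^ 2"
    unfolding F_def N_def S_def using B M by (rule grid_fourth_moment)
  have S0: "0 \<le> S" by (simp add: S_def sum_nonneg)
  show ?thesis
  proof (cases "S = 0")
    case True
    then show ?thesis using E(2) by (simp add: S_def)
  next
    case False
    then have S: "0 < S" using S0 by simp
    \<comment> \<open>the choice for which the fourth moment contributes exactly half of \<open>N * S\<close>\<close>
    define l where "l = sqrt (2 * 4 ^ m * S)"
    have l: "0 < l" "l ^ 2 = 2 * 4 ^ m * S" using S by (auto simp: l_def)
    have pt: "x ^ 2 \<le> l * x + x ^ 4 / l ^ 2" if "0 \<le> x" for x :: real
    proof (cases "x \<le> l")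
      case True
      then have "x ^ 2 \<le> l * x" using that by (simp add: power2_eq_square mult_right_mono)
      then show ?thesis using that by (simp add: add_increasing2)
    next
      case False
      then have "l ^ 2 \<le> x ^ 2" using l(1) by (intro power_mono) auto
      then have "x ^ 2 * l ^ 2 \<le> x ^ 2 * x ^ 2" by (intro mult_left_mono) auto
      then have "x ^ 2 \<le> x ^ 4 / l ^ 2" using l(1) by (simp add: field_simps)
      moreover have "0 \<le> l * x" using that l(1) by simp
      ultimately show ?thesis by linarith
    qed
    have "N * S \<le> (\<Sum>t\<in>grid n M. l * F t + F t ^ 4 / l ^ 2)"
      unfolding F2[symmetric] by (intro sum_mono pt) (simp add: F_def)
    also have "\<dots> = l * (N * E) + (\<Sum>t\<in>grid n M. F t ^ 4) / l ^ 2"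
      by (simp add: sum.distrib sum_distrib_left[symmetric] sum_divide_distrib[symmetric] E(1))
    also have "\<dots> \<le> l * (N * E) + N * 4 ^ m * S ^ 2 / l ^ 2"
      using F4 l(1) by (intro add_left_mono divide_right_mono) auto
    also have "N * 4 ^ m * S ^ 2 / l ^ 2 = N * (S / 2)"
      using S unfolding l(2) by (simp add: field_simps power2_eq_square)
    finally have "N * S \<le> N * (l * E + S / 2)" by (simp add: algebra_simps)
    then have "S / 2 \<le> l * E" using N by simp
    then have "(S / 2) ^ 2 \<le> (l * E) ^ 2" using S by (intro power_mono) auto
    then have "S ^ 2 / 4 \<le> 2 * 4 ^ m * S * E ^ 2"
      unfolding power_mult_distrib power_divide l(2) by simp
    then have "S * S \<le> S * (8 * 4 ^ m * E ^ 2)"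
      by (simp add: power2_eq_square field_simps)
    then show ?thesis using S by (simp add: S_def[symmetric])
  qed
qed

text \<open>
  Interpolation between the bound of each coefficient by \<open>E\<close> and the bound of their sum of squares by
  \<open>8 * 4 ^ m * E ^ 2\<close>. The exponential factor enters with the power \<open>1 / q\<close> only, and so it tends to
  \<open>1\<close> as \<open>q\<close> grows; this is essential for the sharp constant when \<open>p\<close> is close to \<open>m\<close>.
\<close>

lemma grid_lq_le_l1:
  fixes b :: "(nat \<Rightarrow> nat) \<Rightarrow> complex"
  assumes B: "B \<subseteq> multi_indices m n" and M: "2 * m < M" and m: "0 < m" and q: "2 \<le> q"
  defines "E \<equiv> (\<Sum>t\<in>grid n M. norm (\<Sum>\<alpha>\<in>B. b \<alpha> * zpow n (grid_point M t) \<alpha>)) / real (M ^ n)"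
  shows "(\<Sum>\<alpha>\<in>B. norm (b \<alpha>) powr q) powr (1 / q) \<le> 32 powr (m / q) * E"
proof -
  have N: "0 < real (M ^ n)" using M by simp
  have E: "0 \<le> E" unfolding E_def by (intro divide_nonneg_nonneg sum_nonneg) auto
  have coef: "norm (b \<alpha>) \<le> E" if "\<alpha> \<in> B" for \<alpha>
    using grid_coefficient_bound[OF B _ that, of M b] M N by (simp add: E_def field_simps)
  have "(\<Sum>\<alpha>\<in>B. norm (b \<alpha>) powr q) \<le> (\<Sum>\<alpha>\<in>B. E powr (q - 2) * norm (b \<alpha>) ^ 2)"
  proof (rule sum_mono)
    fix \<alpha> assume \<alpha>: "\<alpha> \<in> B"
    show "norm (b \<alpha>) powr q \<le> E powr (q - 2) * norm (b \<alpha>) ^ 2"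
    proof (cases "b \<alpha> = 0")
      case False
      have "norm (b \<alpha>) powr q = norm (b \<alpha>) powr (q - 2) * norm (b \<alpha>) powr 2"
        by (subst powr_add[symmetric]) simp
      also have "\<dots> \<le> E powr (q - 2) * norm (b \<alpha>) powr 2"
        using coef[OF \<alpha>] q by (intro mult_right_mono powr_mono2) auto
      finally show ?thesis using False by simp
    qed (use q in simp)
  qed
  also have "\<dots> \<le> E powr (q - 2) * (8 * 4 ^ m * E ^ 2)"
    unfolding sum_distrib_left[symmetric] using grid_l2_le_l1[OF B M, of b]
    by (intro mult_left_mono) (auto simp: E_def)
  also have "\<dots> = 8 * 4 ^ m * E powr q"
  proof (cases "E = 0")
    case False
    then have "E ^ 2 = E powr 2" using E by simp
    then have "E powr (q - 2) * E ^ 2 = E powr q" by (simp add: powr_add[symmetric])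
    then show ?thesis by simp
  qed simp
  also have "\<dots> \<le> 32 ^ m * E powr q"
  proof (rule mult_right_mono)
    have "(8::real) ^ 1 \<le> 8 ^ m" using m by (intro power_increasing) auto
    then show "(8::real) * 4 ^ m \<le> 32 ^ m"
      using power_mult_distrib[of "8::real" 4 m] by simp
  qed simp
  finally have "(\<Sum>\<alpha>\<in>B. norm (b \<alpha>) powr q) powr (1 / q) \<le> (32 ^ m * E powr q) powr (1 / q)"
    using q by (intro powr_mono2) (auto intro: sum_nonneg)
  also have "\<dots> = 32 powr (m / q) * E"
    using q E by (simp add: powr_mult powr_powr powr_realpow[symmetric])
  finally show ?thesis .
qed

text \<open>
  The aligned coefficient functions are bounded in mean, and the moment comparison turns their mean
  values into norms of coefficients.
\<close>

lemma aligned_lq_bound: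
  fixes b :: "(nat \<Rightarrow> nat) \<Rightarrow> complex"
  assumes bound: "\<And>z. z \<in> torus n \<Longrightarrow> norm (\<Sum>\<alpha>\<in>multi_indices m n. b \<alpha> * zpow n z \<alpha>) \<le> K"
    and V: "V \<subseteq> {..<n}" and d: "0 < d" "d \<le> m" and q: "2 \<le> q"
  shows "(\<Sum>j\<in>V. (\<Sum>\<alpha>\<in>block_slice m n V d j. norm (b \<alpha>) powr q) powr (1 / q)) \<le> 32 powr (m / q) * K"
proof -
  let ?M = "Suc (2 * m)"
  let ?F = "\<lambda>j t. norm (\<Sum>\<alpha>\<in>block_slice m n V d j. b \<alpha> * zpow n (grid_point ?M t) \<alpha>)"
  have "(\<Sum>j\<in>V. (\<Sum>\<alpha>\<in>block_slice m n V d j. norm (b \<alpha>) powr q) powr (1 / q))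
      \<le> (\<Sum>j\<in>V. 32 powr (m / q) * ((\<Sum>t\<in>grid n ?M. ?F j t) / real (?M ^ n)))"
    using d q by (intro sum_mono grid_lq_le_l1) (auto simp: block_slice_def)
  also have "\<dots> = 32 powr (m / q) * ((\<Sum>j\<in>V. \<Sum>t\<in>grid n ?M. ?F j t) / real (?M ^ n))"
    by (simp only: sum_distrib_left[symmetric] sum_divide_distrib[symmetric])
  also have "(\<Sum>j\<in>V. \<Sum>t\<in>grid n ?M. ?F j t) = (\<Sum>t\<in>grid n ?M. \<Sum>j\<in>V. ?F j t)"
    by (rule sum.swap)
  also have "32 powr (m / q) * ((\<Sum>t\<in>grid n ?M. \<Sum>j\<in>V. ?F j t) / real (?M ^ n))
      \<le> 32 powr (m / q) * ((\<Sum>t\<in>grid n ?M. K) / real (?M ^ n))"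
    by (intro mult_left_mono divide_right_mono sum_mono torus_bound_aligned[OF bound V d]) auto
  also have "\<dots> = 32 powr (m / q) * K" by simp
  finally show ?thesis .
qed

section \<open>Colouring the variables\<close>

text \<open>
  The probability that \<open>s\<close> independent colours, uniform among \<open>m\<close>, are pairwise distinct.
\<close>

definition distinct_prob :: "nat \<Rightarrow> nat \<Rightarrow> real" where
  "distinct_prob m s = (\<Prod>t<s. (real m - real t) / real m)"

lemma distinct_prob_pos: "s \<le> m \<Longrightarrow> 0 < distinct_prob m s"
  unfolding distinct_prob_def by (intro prod_pos) auto

lemma distinct_prob_antimono:
  assumes "s \<le> k" "k \<le> m"
  shows "distinct_prob m k \<le> distinct_prob m s"
  using assms
proof (induction rule: dec_induct)
  case (step k)
  then have "distinct_prob m (Suc k) \<le> distinct_prob m k * 1"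
    unfolding distinct_prob_def prod.lessThan_Suc
    by (intro mult_left_mono prod_nonneg) (auto simp: divide_simps)
  then show ?case using step by simp
qed simp

text \<open>
  The probability is \<open>m! / m ^ m\<close>, and \<open>m ^ m / m!\<close> is one term of the series of \<open>exp m\<close>.
\<close>

lemma exp_le_distinct_prob: "exp (- real m) \<le> distinct_prob m m"
proof (cases "m = 0")
  case False
  have fact: "(\<Prod>t<m. real m - real t) = fact m"
  proof -
    have "(\<Prod>t<m. real m - real t) = (\<Prod>t<m. real (m - t))"
      by (intro prod.cong) (auto simp: of_nat_diff)
    also have "\<dots> = real (\<Prod>t<m. m - t)" by simp
    also have "(\<Prod>t<m. m - t) = fact m"
      by (simp add: fact_prod_rev lessThan_atLeast0)
    finally show ?thesis by simp
  qed
  have "(\<Sum>k\<in>{m}. real m ^ k /\<^sub>R fact k) \<le> (\<Sum>k. real m ^ k /\<^sub>R fact k)"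
    by (intro sum_le_suminf summable_exp_generic) auto
  then have "real m ^ m / fact m \<le> exp (real m)" by (simp add: exp_def field_simps)
  then have "1 \<le> exp (real m) * (fact m / real m ^ m)"
    using False by (simp add: field_simps)
  then show ?thesis
    unfolding distinct_prob_def prod_dividef fact
    by (simp add: exp_minus field_simps)
qed (simp add: distinct_prob_def)

text \<open>
  A uniformly random colouring is injective on each \<open>S i\<close> with probability at least \<open>exp (- m)\<close>.
  The random choice is carried out one variable at a time: \<open>w k \<kappa> i\<close> is \<open>f i\<close> divided by the
  probability that the variables of \<open>S i\<close> below \<open>k\<close> get distinct colours, or \<open>0\<close> if \<open>\<kappa>\<close> has failed on
  them. The average of this weight over the colour of the next variable is unchanged, so some colour
  does not decrease the total.
\<close>

lemma exists_injective_colouring: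
  fixes f :: "'i \<Rightarrow> real" and S :: "'i \<Rightarrow> nat set"
  assumes I: "finite I" and f: "\<And>i. i \<in> I \<Longrightarrow> 0 \<le> f i" and m: "0 < m"
    and S: "\<And>i. i \<in> I \<Longrightarrow> S i \<subseteq> {..<n}" "\<And>i. i \<in> I \<Longrightarrow> card (S i) \<le> m"
  obtains \<kappa> :: "nat \<Rightarrow> nat" where "\<And>j. \<kappa> j < m"
    "exp (- real m) * (\<Sum>i\<in>I. f i) \<le> (\<Sum>i\<in>{i\<in>I. inj_on \<kappa> (S i)}. f i)"
proof -
  define w where "w k \<kappa> i = (if inj_on \<kappa> (S i \<inter> {..<k})
      then f i / distinct_prob m (card (S i \<inter> {..<k})) else 0)"
    for k and \<kappa> :: "nat \<Rightarrow> nat" and i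
  have step: "(\<Sum>l<m. w (Suc k) (\<kappa>(k := l)) i) = real m * w k \<kappa> i" if i: "i \<in> I" and \<kappa>: "\<And>j. \<kappa> j < m" for k \<kappa> i
  proof (cases "k \<in> S i")
    case False
    then have eq: "S i \<inter> {..<Suc k} = S i \<inter> {..<k}" by (auto simp: less_Suc_eq)
    have "inj_on (\<kappa>(k := l)) (S i \<inter> {..<k}) \<longleftrightarrow> inj_on \<kappa> (S i \<inter> {..<k})" for l
      by (intro inj_on_cong) auto
    then show ?thesis by (simp add: w_def eq)
  next
    case True
    define T where "T = S i \<inter> {..<k}"
    have T: "finite T" "k \<notin> T" "S i \<inter> {..<Suc k} = insert k T"
      using True by (auto simp: T_def less_Suc_eq)
    have "card (insert k T) \<le> card (S i)"
      using T(3) S(1)[OF i] by (intro card_mono) (auto intro: finite_subset)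
    then have s: "Suc (card T) \<le> m" using S(2)[OF i] T by simp
    have inj: "inj_on (\<kappa>(k := l)) (insert k T) \<longleftrightarrow> inj_on \<kappa> T \<and> l \<notin> \<kappa> ` T" for l
    proof -
      have "inj_on (\<kappa>(k := l)) T \<longleftrightarrow> inj_on \<kappa> T" using T(2) by (intro inj_on_cong) auto
      moreover have "(\<kappa>(k := l)) ` T = \<kappa> ` T" using T(2) by (intro image_cong) auto
      ultimately show ?thesis using T(2) by simp
    qed
    have w_Suc: "w (Suc k) (\<kappa>(k := l)) i
        = (if inj_on \<kappa> T \<and> l \<notin> \<kappa> ` T then f i / distinct_prob m (Suc (card T)) else 0)" for l
      unfolding w_def T(3) inj using T(1,2) by simp
    show ?thesis
    proof (cases "inj_on \<kappa> T")
      case False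
      then show ?thesis by (simp add: w_Suc) (simp add: w_def T_def[symmetric])
    next
      case inj\<kappa>: True
      have sub: "\<kappa> ` T \<subseteq> {..<m}" using \<kappa> by auto
      have "(\<Sum>l<m. w (Suc k) (\<kappa>(k := l)) i)
          = (\<Sum>l<m. if l \<notin> \<kappa> ` T then f i / distinct_prob m (Suc (card T)) else 0)"
        using inj\<kappa> by (simp add: w_Suc)
      also have "\<dots> = real (card ({..<m} - \<kappa> ` T)) * (f i / distinct_prob m (Suc (card T)))"
        by (subst sum.inter_filter[symmetric]) (simp_all add: set_diff_eq lessThan_def)
      also have "card ({..<m} - \<kappa> ` T) = m - card T"
        using card_Diff_subset[OF _ sub] card_image[OF inj\<kappa>] T(1) by simp
      finally have "(\<Sum>l<m. w (Suc k) (\<kappa>(k := l)) i)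
          = real (m - card T) * (f i / distinct_prob m (Suc (card T)))" .
      also have "\<dots> = real m * (f i / distinct_prob m (card T))"
        using s m by (simp add: distinct_prob_def of_nat_diff field_simps)
      finally show ?thesis using inj\<kappa> by (simp add: w_def T_def[symmetric])
    qed
  qed
  have "\<exists>\<kappa>. (\<forall>j. \<kappa> j < m) \<and> (\<Sum>i\<in>I. f i) \<le> (\<Sum>i\<in>I. w k \<kappa> i)" for k
  proof (induction k)
    case 0
    then show ?case using m by (intro exI[of _ "\<lambda>_. 0"]) (simp add: w_def distinct_prob_def)
  next
    case (Suc k)
    then obtain \<kappa> where \<kappa>: "\<And>j. \<kappa> j < m" "(\<Sum>i\<in>I. f i) \<le> (\<Sum>i\<in>I. w k \<kappa> i)" by blast
    \<comment> \<open>the average over the colours \<open>l\<close> of \<open>k\<close> equals the old total, so not all of them can be smaller\<close>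
    have "\<exists>l<m. (\<Sum>i\<in>I. w k \<kappa> i) \<le> (\<Sum>i\<in>I. w (Suc k) (\<kappa>(k := l)) i)"
    proof (rule ccontr)
      assume "\<not> ?thesis"
      then have less: "(\<Sum>i\<in>I. w (Suc k) (\<kappa>(k := l)) i) < (\<Sum>i\<in>I. w k \<kappa> i)" if "l < m" for l
        using that by (auto simp: not_le)
      have "(\<Sum>l<m. \<Sum>i\<in>I. w (Suc k) (\<kappa>(k := l)) i) < (\<Sum>l<m. \<Sum>i\<in>I. w k \<kappa> i)"
        by (rule sum_strict_mono) (use m less in auto)
      moreover have "(\<Sum>l<m. \<Sum>i\<in>I. w (Suc k) (\<kappa>(k := l)) i) = (\<Sum>l<m. \<Sum>i\<in>I. w k \<kappa> i)"
        by (subst sum.swap) (simp add: step \<kappa>(1) sum_distrib_left)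
      ultimately show False by simp
    qed
    then obtain l where l: "l < m" "(\<Sum>i\<in>I. w k \<kappa> i) \<le> (\<Sum>i\<in>I. w (Suc k) (\<kappa>(k := l)) i)"
      by blast
    have "\<forall>j. (\<kappa>(k := l)) j < m" using \<kappa>(1) l(1) by simp
    moreover have "(\<Sum>i\<in>I. f i) \<le> (\<Sum>i\<in>I. w (Suc k) (\<kappa>(k := l)) i)"
      using \<kappa>(2) l(2) by (rule order_trans)
    ultimately show ?case by blast
  qed
  then obtain \<kappa> where \<kappa>: "\<And>j. \<kappa> j < m" "(\<Sum>i\<in>I. f i) \<le> (\<Sum>i\<in>I. w n \<kappa> i)" by blast
  have "(\<Sum>i\<in>I. w n \<kappa> i) = (\<Sum>i\<in>{i\<in>I. inj_on \<kappa> (S i)}. f i / distinct_prob m (card (S i)))"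
  proof -
    have "w n \<kappa> i = (if inj_on \<kappa> (S i) then f i / distinct_prob m (card (S i)) else 0)"
      if "i \<in> I" for i
      unfolding w_def Int_absorb2[OF S(1)[OF that]] ..
    then show ?thesis by (simp add: sum.inter_filter[OF I])
  qed
  also have "\<dots> \<le> (\<Sum>i\<in>{i\<in>I. inj_on \<kappa> (S i)}. exp (real m) * f i)"
  proof (rule sum_mono)
    fix i assume "i \<in> {i\<in>I. inj_on \<kappa> (S i)}"
    then have i: "i \<in> I" by simp
    have "exp (- real m) \<le> distinct_prob m (card (S i))"
      using exp_le_distinct_prob distinct_prob_antimono[OF S(2)[OF i] order_refl] order_trans by blast
    then have "f i / distinct_prob m (card (S i)) \<le> f i / exp (- real m)"
      using f[OF i] distinct_prob_pos[OF S(2)[OF i]] by (intro divide_left_mono mult_pos_pos) auto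
    then show "f i / distinct_prob m (card (S i)) \<le> exp (real m) * f i"
      by (simp add: exp_minus field_simps)
  qed
  finally have "(\<Sum>i\<in>I. f i) \<le> exp (real m) * (\<Sum>i\<in>{i\<in>I. inj_on \<kappa> (S i)}. f i)"
    using \<kappa>(2) by (simp add: sum_distrib_left)
  then have "exp (- real m) * (\<Sum>i\<in>I. f i) \<le> (\<Sum>i\<in>{i\<in>I. inj_on \<kappa> (S i)}. f i)"
    by (simp add: exp_minus field_simps)
  then show ?thesis using that \<kappa>(1) by blast
qed

section \<open>Weights of large entropy\<close>

lemma sum_weighted_ln_le:
  fixes p x :: "'a \<Rightarrow> real"
  assumes "finite S" "\<And>i. i \<in> S \<Longrightarrow> 0 \<le> p i" "sum p S = 1" "\<And>i. i \<in> S \<Longrightarrow> 0 < x i"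
  shows "(\<Sum>i\<in>S. p i * ln (x i)) \<le> ln (\<Sum>i\<in>S. p i * x i)"
proof -
  have "S \<noteq> {}" using assms(3) by auto
  then show ?thesis
    using concave_on_sum[OF assms(1) _ ln_concave assms(3), of x] assms(2,4) by simp
qed

text \<open>
  If no two variables of \<open>\<alpha>\<close> share a colour, the degree of \<open>\<alpha>\<close> in a colour class is the exponent of
  the only variable of that colour.
\<close>

lemma injective_colouring_block_slice:
  assumes \<alpha>: "\<alpha> \<in> multi_indices m n" and inj: "inj_on \<kappa> {j. j < n \<and> 0 < \<alpha> j}"
    and deg: "(\<Sum>i\<in>{i. i < n \<and> \<kappa> i = \<kappa> j}. \<alpha> i) = d" and j: "j < n" "0 < \<alpha> j"
  shows "\<alpha> \<in> block_slice m n {i. i < n \<and> \<kappa> i = \<kappa> j} d j"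
proof -
  have zero: "\<alpha> i = 0" if "i \<in> {i. i < n \<and> \<kappa> i = \<kappa> j} - {j}" for i
    using inj_onD[OF inj, of i j] that j by auto
  then have "(\<Sum>i\<in>{i. i < n \<and> \<kappa> i = \<kappa> j}. \<alpha> i) = \<alpha> j"
    using j by (subst sum.remove[of _ j]) auto
  then show ?thesis using zero \<alpha> deg by (auto simp: block_slice_def)
qed

text \<open>
  Let \<open>\<alpha>\<close> be random with distribution \<open>\<phi>\<close>. For a colour \<open>l\<close> with \<open>d l > 0\<close> there is exactly one variable
  of \<open>\<alpha>\<close> of this colour; it is a random variable with distribution \<open>g\<close> on the colour class and with
  entropy \<open>H l\<close>. With \<open>w j powr p = d (\<kappa> j) * g j / m\<close> the logarithm of \<open>w^\<alpha>\<close> has expectation at least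
  \<open>- (\<Sum> d l * H l) / p - m / p * ln m\<close>. By Jensen's inequality, applied to the inner sum with the
  conditional distribution of \<open>\<alpha>\<close> and to the outer sum with \<open>g\<close>, the logarithm of the right-hand side
  of the estimate is at least this expectation plus \<open>m / p\<close> times the entropy of the chosen colour.
  Since \<open>\<Sum> d l = m\<close>, a colour of maximal entropy compensates for the first term.
\<close>

lemma entropy_lower_bound:
  fixes A :: "(nat \<Rightarrow> nat) set" and \<phi> :: "(nat \<Rightarrow> nat) \<Rightarrow> real" and \<kappa> d :: "nat \<Rightarrow> nat" and p q :: real
  assumes A: "A \<subseteq> multi_indices m n" and m: "0 < m"
    and \<phi>: "\<And>\<alpha>. \<alpha> \<in> A \<Longrightarrow> 0 < \<phi> \<alpha>" "sum \<phi> A = 1"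
    and \<kappa>: "\<And>j. \<kappa> j < m"
    and deg: "\<And>\<alpha> l. \<alpha> \<in> A \<Longrightarrow> l < m \<Longrightarrow> (\<Sum>j\<in>{j. j < n \<and> \<kappa> j = l}. \<alpha> j) = d l"
    and inj: "\<And>\<alpha>. \<alpha> \<in> A \<Longrightarrow> inj_on \<kappa> {j. j < n \<and> 0 < \<alpha> j}"
    and p: "real m < p" and q: "q = p / (p - real m)"
  obtains w :: "nat \<Rightarrow> real" and l where
    "\<And>j. 0 \<le> w j" "(\<Sum>j<n. w j powr p) \<le> 1" "l < m" "0 < d l"
    "real m powr (- (m / p)) \<le>
      (\<Sum>j\<in>{j. j < n \<and> \<kappa> j = l}. (\<Sum>\<alpha>\<in>{\<alpha>\<in>A. 0 < \<alpha> j}. \<phi> \<alpha> * zpow n w \<alpha> powr q) powr (1 / q))"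
proof -
  have fA: "finite A" using A finite_subset by blast
  have p0: "0 < p" and q0: "0 < q" and q1: "1 / q = 1 - m / p" using p m by (auto simp: q field_simps)
  define V where "V l = {j. j < n \<and> \<kappa> j = l}" for l
  have fV: "finite (V l)" for l by (simp add: V_def)
  have split: "(\<Sum>j<n. f j) = (\<Sum>l<m. \<Sum>j\<in>V l. f j)" for f :: "nat \<Rightarrow> real"
  proof -
    have "(\<Sum>l<m. \<Sum>j\<in>{j\<in>{..<n}. \<kappa> j = l}. f j) = (\<Sum>j<n. f j)"
      using \<kappa> by (intro sum.group) auto
    then show ?thesis by (simp add: V_def)
  qed
  define g where "g j = (\<Sum>\<alpha>\<in>{\<alpha>\<in>A. 0 < \<alpha> j}. \<phi> \<alpha>)" for j
  have g0: "0 \<le> g j" for j unfolding g_def using \<phi>(1) by (intro sum_nonneg) (auto intro: less_imp_le)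
  have \<alpha>_val: "\<alpha> j = d (\<kappa> j)" if "\<alpha> \<in> A" "j < n" "0 < \<alpha> j" for \<alpha> j
    using injective_colouring_block_slice[OF _ inj[OF that(1)] deg[OF that(1) \<kappa>] that(2,3)] A that(1)
    by (auto simp: block_slice_def)
  \<comment> \<open>each colour of positive degree meets the support of \<open>\<alpha>\<close> exactly once\<close>
  have one: "(\<Sum>j\<in>V l. if 0 < \<alpha> j then c else 0) = c" if "\<alpha> \<in> A" "l < m" "0 < d l" for \<alpha> l and c :: real
  proof -
    have "\<exists>j\<in>V l. 0 < \<alpha> j"
      using deg[OF that(1,2)] that(3) unfolding V_def by (metis (no_types, lifting) not_gr_zero sum.neutral)
    then obtain j where j: "j \<in> V l" "0 < \<alpha> j" by blast
    have "\<not> 0 < \<alpha> i" if i: "i \<in> V l - {j}" for i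
      using inj_onD[OF inj[OF \<open>\<alpha> \<in> A\<close>], of i j] i j by (auto simp: V_def)
    then have "(\<Sum>i\<in>V l - {j}. if 0 < \<alpha> i then c else 0) = 0" by (intro sum.neutral) auto
    then show ?thesis using j fV by (subst sum.remove[of _ j]) auto
  qed
  have swap: "(\<Sum>j\<in>V l. \<Sum>\<alpha>\<in>{\<alpha>\<in>A. 0 < \<alpha> j}. f \<alpha>) = (\<Sum>\<alpha>\<in>A. f \<alpha>)" if "l < m" "0 < d l"
    for l and f :: "(nat \<Rightarrow> nat) \<Rightarrow> real"
  proof -
    have "(\<Sum>j\<in>V l. \<Sum>\<alpha>\<in>{\<alpha>\<in>A. 0 < \<alpha> j}. f \<alpha>) = (\<Sum>\<alpha>\<in>A. \<Sum>j\<in>V l. if 0 < \<alpha> j then f \<alpha> else 0)"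
      by (subst sum.swap) (simp add: sum.inter_filter[OF fA])
    also have "\<dots> = (\<Sum>\<alpha>\<in>A. f \<alpha>)" using one that by (intro sum.cong) auto
    finally show ?thesis .
  qed
  have g_sum: "(\<Sum>j\<in>V l. g j) = 1" if "l < m" "0 < d l" for l
    unfolding g_def using swap[OF that] \<phi>(2) by simp
  have "A \<noteq> {}" using \<phi>(2) by auto
  then obtain \<alpha>0 where \<alpha>0: "\<alpha>0 \<in> A" by blast
  have d_sum: "(\<Sum>l<m. real (d l)) = real m"
  proof -
    have "(\<Sum>l<m. real (d l)) = (\<Sum>l<m. \<Sum>j\<in>V l. real (\<alpha>0 j))"
      using deg[OF \<alpha>0] by (intro sum.cong) (auto simp: V_def simp flip: of_nat_sum)
    also have "\<dots> = (\<Sum>j<n. real (\<alpha>0 j))" by (simp add: split)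
    also have "\<dots> = real m" using sum_multi_index[of \<alpha>0 m n] A \<alpha>0 by (auto simp flip: of_nat_sum)
    finally show ?thesis .
  qed
  define H where "H l = - (\<Sum>j\<in>V l. g j * ln (g j))" for l
  define L where "L = {l. l < m \<and> 0 < d l}"
  have "finite L" "L \<noteq> {}"
  proof -
    show "finite L" by (simp add: L_def)
    show "L \<noteq> {}"
    proof
      assume "L = {}"
      then have "(\<Sum>l<m. real (d l)) = 0" by (auto simp: L_def)
      then show False using d_sum m by simp
    qed
  qed
  then have "Max (H ` L) \<in> H ` L" by (intro Max_in) auto
  then obtain Y where "Y \<in> L" "Max (H ` L) = H Y" by blast
  then have Y: "Y \<in> L" "\<And>l. l \<in> L \<Longrightarrow> H l \<le> H Y"
    using \<open>finite L\<close> by (auto simp flip: \<open>Max (H ` L) = H Y\<close>)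
  have Y': "Y < m" "0 < d Y" using Y(1) by (auto simp: L_def)
  define w where "w j = (d (\<kappa> j) * g j / m) powr (1 / p)" for j
  have w0: "0 \<le> w j" for j by (simp add: w_def)
  have w_sum: "(\<Sum>j<n. w j powr p) \<le> 1"
  proof -
    have "(\<Sum>j<n. w j powr p) = (\<Sum>j<n. d (\<kappa> j) * g j / m)"
      using p0 g0 by (simp add: w_def powr_powr)
    also have "\<dots> = (\<Sum>l<m. \<Sum>j\<in>V l. d l * g j / m)"
      unfolding split by (intro sum.cong refl) (simp add: V_def)
    also have "\<dots> = (\<Sum>l<m. d l * (\<Sum>j\<in>V l. g j) / m)"
      by (simp add: sum_distrib_left sum_divide_distrib)
    also have "\<dots> = (\<Sum>l<m. d l / m)"
      using g_sum by (intro sum.cong refl) (metis lessThan_iff mult.right_neutral mult_zero_left not_gr_zero of_nat_0)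
    also have "\<dots> = 1" using d_sum m by (simp add: sum_divide_distrib[symmetric])
    finally show ?thesis by simp
  qed
  have g_pos: "0 < g j" if "\<alpha> \<in> A" "0 < \<alpha> j" for \<alpha> j
  proof -
    have "\<phi> \<alpha> \<le> g j" unfolding g_def using that fA \<phi>(1)
      by (intro member_le_sum) (auto intro: less_imp_le)
    then show ?thesis using \<phi>(1)[OF that(1)] by linarith
  qed
  have w_pos: "0 < w j" if "\<alpha> \<in> A" "j < n" "0 < \<alpha> j" for \<alpha> j
    using g_pos[OF that(1,3)] \<alpha>_val[OF that] that(3) m by (simp add: w_def)
  define W where "W \<alpha> = zpow n w \<alpha>" for \<alpha>
  have W_pos: "0 < W \<alpha>" if "\<alpha> \<in> A" for \<alpha>
    unfolding W_def
  proof (intro prod_pos)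
    fix j assume "j \<in> {..<n}"
    then show "0 < w j ^ \<alpha> j" using w_pos[OF that, of j] by (cases "\<alpha> j = 0") auto
  qed
  \<comment> \<open>since \<open>d (\<kappa> j) \<ge> 1\<close> on the support, the factors \<open>d (\<kappa> j)\<close> of the weights can be dropped\<close>
  have W_ln: "(\<Sum>j<n. \<alpha> j * ln (g j)) / p - m / p * ln m \<le> ln (W \<alpha>)" if \<alpha>: "\<alpha> \<in> A" for \<alpha>
  proof -
    have "ln (W \<alpha>) = (\<Sum>j<n. ln (w j ^ \<alpha> j))"
      unfolding W_def
    proof (rule ln_prod)
      fix j assume "j \<in> {..<n}"
      then show "w j ^ \<alpha> j \<noteq> 0" using w_pos[OF \<alpha>, of j] by (cases "\<alpha> j = 0") auto
    qed simp
    also have "\<dots> \<ge> (\<Sum>j<n. (\<alpha> j * ln (g j) - \<alpha> j * ln m) / p)"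
    proof (rule sum_mono)
      fix j assume "j \<in> {..<n}"
      then have j: "j < n" by simp
      show "(\<alpha> j * ln (g j) - \<alpha> j * ln m) / p \<le> ln (w j ^ \<alpha> j)"
      proof (cases "\<alpha> j = 0")
        case False
        then have pos: "0 < \<alpha> j" by simp
        have d: "1 \<le> d (\<kappa> j)" using \<alpha>_val[OF \<alpha> j pos] pos by simp
        have "ln (w j ^ \<alpha> j) = \<alpha> j * ln (w j)" by (simp add: ln_realpow)
        also have "ln (w j) = (ln (d (\<kappa> j)) + ln (g j) - ln m) / p"
          using g_pos[OF \<alpha> pos] d m by (simp add: w_def ln_powr ln_div ln_mult)
        also have "\<alpha> j * \<dots> \<ge> \<alpha> j * ((ln (g j) - ln m) / p)"
          using d p0 by (intro mult_left_mono divide_right_mono) auto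
        finally show ?thesis by (simp add: field_simps)
      qed simp
    qed
    finally have "(\<Sum>j<n. (\<alpha> j * ln (g j) - \<alpha> j * ln m) / p) \<le> ln (W \<alpha>)" .
    moreover have "(\<Sum>j<n. (\<alpha> j * ln (g j) - \<alpha> j * ln m) / p)
        = (\<Sum>j<n. \<alpha> j * ln (g j)) / p - m / p * ln m"
    proof -
      have "(\<Sum>j<n. real (\<alpha> j)) = m" using sum_multi_index[of \<alpha> m n] A \<alpha> by (auto simp flip: of_nat_sum)
      then show ?thesis
        by (simp add: sum_divide_distrib[symmetric] sum_subtractf sum_distrib_right[symmetric] diff_divide_distrib)
    qed
    ultimately show ?thesis by simp
  qed
  define X where "X j = (\<Sum>\<alpha>\<in>{\<alpha>\<in>A. 0 < \<alpha> j}. \<phi> \<alpha> * W \<alpha> powr q)" for j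
  \<comment> \<open>variables that do not occur in \<open>A\<close> have \<open>g j = 0\<close> and are left out before logarithms are taken\<close>
  define V' where "V' = {j\<in>V Y. 0 < g j}"
  have fV': "finite V'" by (simp add: V'_def fV)
  have V'_sum: "(\<Sum>j\<in>V Y. f j) = (\<Sum>j\<in>V'. f j)" if "\<And>j. g j = 0 \<Longrightarrow> f j = 0" for f :: "nat \<Rightarrow> real"
    unfolding V'_def using fV that g0 by (intro sum.mono_neutral_right) (auto simp: less_le)
  have empty: "{\<alpha>\<in>A. 0 < \<alpha> j} = {}" if "g j = 0" for j
    using g_pos that by force
  have X_ln: "ln (g j) + (\<Sum>\<alpha>\<in>{\<alpha>\<in>A. 0 < \<alpha> j}. \<phi> \<alpha> * (q * ln (W \<alpha>))) / g j \<le> ln (X j)"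
    and X_pos: "0 < X j" if "j \<in> V'" for j
  proof -
    have gj: "0 < g j" using that by (simp add: V'_def)
    have "(\<Sum>\<alpha>\<in>{\<alpha>\<in>A. 0 < \<alpha> j}. \<phi> \<alpha> / g j * ln (W \<alpha> powr q))
        \<le> ln (\<Sum>\<alpha>\<in>{\<alpha>\<in>A. 0 < \<alpha> j}. \<phi> \<alpha> / g j * W \<alpha> powr q)"
    proof (rule sum_weighted_ln_le)
      show "(\<Sum>\<alpha>\<in>{\<alpha>\<in>A. 0 < \<alpha> j}. \<phi> \<alpha> / g j) = 1"
        using gj by (simp add: sum_divide_distrib[symmetric] g_def)
      show "0 < W i powr q" if "i \<in> {\<alpha>\<in>A. 0 < \<alpha> j}" for i
        using W_pos[of i] that by simp
    qed (use fA \<phi>(1) gj in \<open>auto intro: less_imp_le\<close>)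
    moreover have "(\<Sum>\<alpha>\<in>{\<alpha>\<in>A. 0 < \<alpha> j}. \<phi> \<alpha> / g j * W \<alpha> powr q) = X j / g j"
      by (simp add: X_def sum_divide_distrib)
    moreover have "(\<Sum>\<alpha>\<in>{\<alpha>\<in>A. 0 < \<alpha> j}. \<phi> \<alpha> / g j * ln (W \<alpha> powr q))
        = (\<Sum>\<alpha>\<in>{\<alpha>\<in>A. 0 < \<alpha> j}. \<phi> \<alpha> * (q * ln (W \<alpha>))) / g j"
      unfolding sum_divide_distrib using W_pos by (intro sum.cong refl) (auto simp: ln_powr)
    moreover show Xj: "0 < X j"
    proof -
      have "{\<alpha>\<in>A. 0 < \<alpha> j} \<noteq> {}" using gj unfolding g_def by (metis less_irrefl sum.empty)
      moreover have "0 < \<phi> \<alpha> * W \<alpha> powr q" if "\<alpha> \<in> {\<alpha>\<in>A. 0 < \<alpha> j}" for \<alpha>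
        using \<phi>(1)[of \<alpha>] W_pos[of \<alpha>] that by simp
      ultimately show ?thesis unfolding X_def using fA by (intro sum_pos) auto
    qed
    ultimately show "ln (g j) + (\<Sum>\<alpha>\<in>{\<alpha>\<in>A. 0 < \<alpha> j}. \<phi> \<alpha> * (q * ln (W \<alpha>))) / g j \<le> ln (X j)"
      using gj by (simp add: ln_div)
  qed
  define S where "S = (\<Sum>j\<in>V Y. X j powr (1 / q))"
  have S_ge: "(\<Sum>j\<in>V'. X j powr (1 / q)) \<le> S"
    unfolding S_def V'_def using fV by (intro sum_mono2) auto
  have V'_g: "(\<Sum>j\<in>V'. g j) = 1" using V'_sum[of g] g_sum[OF Y'] by simp
  then have "V' \<noteq> {}" by auto
  then have S_pos: "0 < (\<Sum>j\<in>V'. X j powr (1 / q))"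
    using fV' X_pos by (intro sum_pos) (auto simp: less_imp_neq[symmetric] dest: X_pos)
  \<comment> \<open>the comparison of the entropies, where the maximality of \<open>Y\<close> is used\<close>
  have "- (m / p) * ln m \<le> (1 / q - 1) * (\<Sum>j\<in>V'. g j * ln (g j)) + (\<Sum>\<alpha>\<in>A. \<phi> \<alpha> * ln (W \<alpha>))"
  proof -
    have HY: "(\<Sum>j\<in>V'. g j * ln (g j)) = - H Y"
      using V'_sum[of "\<lambda>j. g j * ln (g j)"] by (simp add: H_def)
    have "(\<Sum>\<alpha>\<in>A. \<phi> \<alpha> * ((\<Sum>j<n. \<alpha> j * ln (g j)) / p - m / p * ln m))
        \<le> (\<Sum>\<alpha>\<in>A. \<phi> \<alpha> * ln (W \<alpha>))"
      using W_ln \<phi>(1) by (intro sum_mono mult_left_mono) (auto intro: less_imp_le)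
    moreover have "(\<Sum>\<alpha>\<in>A. \<phi> \<alpha> * ((\<Sum>j<n. \<alpha> j * ln (g j)) / p - m / p * ln m))
        = (\<Sum>\<alpha>\<in>A. \<phi> \<alpha> * (\<Sum>j<n. \<alpha> j * ln (g j))) / p - m / p * ln m"
    proof -
      have "(\<Sum>\<alpha>\<in>A. \<phi> \<alpha> * ((\<Sum>j<n. \<alpha> j * ln (g j)) / p - m / p * ln m))
          = (\<Sum>\<alpha>\<in>A. \<phi> \<alpha> * (\<Sum>j<n. \<alpha> j * ln (g j))) / p - (\<Sum>\<alpha>\<in>A. \<phi> \<alpha>) * (m / p * ln m)"
        by (simp only: right_diff_distrib sum_subtractf times_divide_eq_right sum_divide_distrib[symmetric]
            sum_distrib_right)
      then show ?thesis using \<phi>(2) by simp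
    qed
    moreover have "(\<Sum>\<alpha>\<in>A. \<phi> \<alpha> * (\<Sum>j<n. \<alpha> j * ln (g j))) = - (\<Sum>l<m. d l * H l)"
    proof -
      have gc: "(\<Sum>\<alpha>\<in>A. if 0 < \<alpha> j then \<phi> \<alpha> * c else 0) = g j * c" for j c
        unfolding g_def sum_distrib_right by (simp add: sum.inter_filter[OF fA])
      have "(\<Sum>\<alpha>\<in>A. \<phi> \<alpha> * (\<Sum>j<n. \<alpha> j * ln (g j)))
          = (\<Sum>\<alpha>\<in>A. \<Sum>j<n. if 0 < \<alpha> j then \<phi> \<alpha> * (d (\<kappa> j) * ln (g j)) else 0)"
        unfolding sum_distrib_left using \<alpha>_val by (intro sum.cong refl) auto
      also have "\<dots> = (\<Sum>j<n. \<Sum>\<alpha>\<in>A. if 0 < \<alpha> j then \<phi> \<alpha> * (d (\<kappa> j) * ln (g j)) else 0)"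
        by (rule sum.swap)
      also have "\<dots> = (\<Sum>j<n. g j * (d (\<kappa> j) * ln (g j)))"
        by (simp only: gc)
      also have "\<dots> = (\<Sum>l<m. \<Sum>j\<in>V l. d l * (g j * ln (g j)))"
        unfolding split by (intro sum.cong refl) (simp add: V_def)
      also have "\<dots> = - (\<Sum>l<m. d l * H l)"
        by (simp add: H_def sum_distrib_left[symmetric] sum_negf)
      finally show ?thesis .
    qed
    moreover have "(\<Sum>l<m. d l * H l) \<le> m * H Y"
    proof -
      have "(\<Sum>l<m. d l * H l) \<le> (\<Sum>l<m. d l * H Y)"
      proof (rule sum_mono)
        fix l assume "l \<in> {..<m}"
        then show "d l * H l \<le> d l * H Y"
          using Y(2)[of l] by (cases "d l = 0") (auto simp: L_def intro: mult_left_mono)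
      qed
      also have "\<dots> = m * H Y" using d_sum by (simp add: sum_distrib_right[symmetric])
      finally show ?thesis .
    qed
    then have "(\<Sum>l<m. d l * H l) / p \<le> m * H Y / p" using p0 by (intro divide_right_mono) auto
    ultimately show ?thesis unfolding HY q1 by (simp add: field_simps)
  qed
  also have "\<dots> = (\<Sum>j\<in>V'. g j * ((1 / q - 1) * ln (g j))
      + (\<Sum>\<alpha>\<in>{\<alpha>\<in>A. 0 < \<alpha> j}. \<phi> \<alpha> * ln (W \<alpha>)))"
  proof -
    have "(\<Sum>\<alpha>\<in>A. \<phi> \<alpha> * ln (W \<alpha>)) = (\<Sum>j\<in>V Y. \<Sum>\<alpha>\<in>{\<alpha>\<in>A. 0 < \<alpha> j}. \<phi> \<alpha> * ln (W \<alpha>))"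
      using swap[OF Y'] by simp
    also have "\<dots> = (\<Sum>j\<in>V'. \<Sum>\<alpha>\<in>{\<alpha>\<in>A. 0 < \<alpha> j}. \<phi> \<alpha> * ln (W \<alpha>))"
      by (rule V'_sum) (simp only: empty sum.empty)
    finally show ?thesis by (simp add: sum.distrib sum_distrib_left mult_ac)
  qed
  also have "\<dots> \<le> (\<Sum>j\<in>V'. g j * ln (X j powr (1 / q) / g j))"
  proof (rule sum_mono)
    fix j assume j: "j \<in> V'"
    then have gj: "0 < g j" by (simp add: V'_def)
    define T where "T = (\<Sum>\<alpha>\<in>{\<alpha>\<in>A. 0 < \<alpha> j}. \<phi> \<alpha> * ln (W \<alpha>))"
    have T: "(\<Sum>\<alpha>\<in>{\<alpha>\<in>A. 0 < \<alpha> j}. \<phi> \<alpha> * (q * ln (W \<alpha>))) = q * T"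
      by (simp add: T_def sum_distrib_left mult_ac)
    have "g j * ((1 / q) * (ln (g j) + q * T / g j)) \<le> g j * ((1 / q) * ln (X j))"
      using X_ln[OF j] gj q0 unfolding T by (intro mult_left_mono) auto
    moreover have "g j * ((1 / q) * (ln (g j) + q * T / g j)) = g j * ((1 / q) * ln (g j)) + T"
      using gj q0 by (simp add: field_simps)
    ultimately have "g j * ((1 / q) * ln (g j)) + T \<le> g j * ((1 / q) * ln (X j))" by simp
    moreover have "g j * (a * u) + T \<le> g j * (a * v) \<Longrightarrow> g j * ((a - 1) * u) + T \<le> g j * (a * v - u)"
      for a u v :: real by (simp add: algebra_simps)
    ultimately have "g j * ((1 / q - 1) * ln (g j)) + T \<le> g j * ((1 / q) * ln (X j) - ln (g j))" by blast
    moreover have "ln (X j powr (1 / q) / g j) = (1 / q) * ln (X j) - ln (g j)"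
      using X_pos[OF j] gj by (simp add: ln_div ln_powr)
    ultimately show "g j * ((1 / q - 1) * ln (g j)) + (\<Sum>\<alpha>\<in>{\<alpha>\<in>A. 0 < \<alpha> j}. \<phi> \<alpha> * ln (W \<alpha>))
        \<le> g j * ln (X j powr (1 / q) / g j)"
      unfolding T_def by simp
  qed
  also have "\<dots> \<le> ln (\<Sum>j\<in>V'. g j * (X j powr (1 / q) / g j))"
  proof (rule sum_weighted_ln_le)
    show "0 < X j powr (1 / q) / g j" if "j \<in> V'" for j
      using X_pos[OF that] that by (simp add: V'_def)
  qed (use V'_g fV' in \<open>auto simp: V'_def\<close>)
  also have "(\<Sum>j\<in>V'. g j * (X j powr (1 / q) / g j)) = (\<Sum>j\<in>V'. X j powr (1 / q))"
    by (intro sum.cong refl) (simp add: V'_def)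
  finally have "exp (- (m / p) * ln m) \<le> (\<Sum>j\<in>V'. X j powr (1 / q))"
    using S_pos by (simp add: ln_ge_iff)
  then have "real m powr (- (m / p)) \<le> S"
    using S_ge m by (simp add: powr_def)
  then show ?thesis
    using that[OF w0 w_sum Y'] unfolding S_def X_def V_def W_def by blast
qed

section \<open>The upper bound for complex forms\<close>

lemma exists_large_fibre:
  fixes f :: "'i \<Rightarrow> real"
  assumes "finite J" "finite T" "\<And>i. i \<in> J \<Longrightarrow> D i \<in> T" "J \<noteq> {}"
  obtains d where "d \<in> T" "sum f J \<le> real (card T) * (\<Sum>i\<in>{i\<in>J. D i = d}. f i)"
proof -
  have "T \<noteq> {}" using assms(3,4) by auto
  have "\<exists>d\<in>T. sum f J / card T \<le> (\<Sum>i\<in>{i\<in>J. D i = d}. f i)"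
  proof (rule ccontr)
    assume "\<not> ?thesis"
    then have less: "(\<Sum>i\<in>{i\<in>J. D i = d}. f i) < sum f J / card T" if "d \<in> T" for d
      using that by (auto simp: not_le)
    have "(\<Sum>d\<in>T. \<Sum>i\<in>{i\<in>J. D i = d}. f i) < (\<Sum>d\<in>T. sum f J / card T)"
      by (rule sum_strict_mono) (use assms \<open>T \<noteq> {}\<close> less in auto)
    moreover have "(\<Sum>d\<in>T. \<Sum>i\<in>{i\<in>J. D i = d}. f i) = sum f J"
      using assms by (intro sum.group) auto
    ultimately show False using \<open>T \<noteq> {}\<close> assms(2) by simp
  qed
  then obtain d where "d \<in> T" "sum f J / card T \<le> (\<Sum>i\<in>{i\<in>J. D i = d}. f i)" by blast
  then show ?thesis using that[of d] \<open>T \<noteq> {}\<close> assms(2) by (simp add: field_simps card_gt_0_iff)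
qed

lemma card_support_le:
  assumes "\<alpha> \<in> multi_indices m n"
  shows "card {j. j < n \<and> 0 < \<alpha> j} \<le> m"
proof -
  have "card {j. j < n \<and> 0 < \<alpha> j} = (\<Sum>j\<in>{j. j < n \<and> 0 < \<alpha> j}. 1)" by simp
  also have "\<dots> \<le> (\<Sum>j\<in>{j. j < n \<and> 0 < \<alpha> j}. \<alpha> j)" by (intro sum_mono) auto
  also have "\<dots> \<le> (\<Sum>j<n. \<alpha> j)" by (intro sum_mono2) auto
  finally show ?thesis using sum_multi_index[OF assms] by simp
qed

text \<open>
  First choose a colouring that is injective on many supports, then a vector \<open>d\<close> of
  colour degrees that carries a large share of the sum. This vector is itself a multi-index of degree \<open>m\<close> in \<open>m\<close> variables, so there are
  at most \<open>4 ^ m\<close> candidates.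
\<close>

lemma exists_homogeneous_colouring:
  fixes f :: "(nat \<Rightarrow> nat) \<Rightarrow> real"
  assumes m: "0 < m" and f: "\<And>\<alpha>. 0 \<le> f \<alpha>" and pos: "0 < (\<Sum>\<alpha>\<in>multi_indices m n. f \<alpha>)"
  obtains \<kappa> d :: "nat \<Rightarrow> nat" and A where
    "A \<subseteq> multi_indices m n" "\<And>j. \<kappa> j < m" "d \<in> multi_indices m m"
    "\<And>\<alpha>. \<alpha> \<in> A \<Longrightarrow> 0 < f \<alpha>"
    "\<And>\<alpha>. \<alpha> \<in> A \<Longrightarrow> inj_on \<kappa> {j. j < n \<and> 0 < \<alpha> j}"
    "\<And>\<alpha> l. \<alpha> \<in> A \<Longrightarrow> l < m \<Longrightarrow> (\<Sum>j\<in>{j. j < n \<and> \<kappa> j = l}. \<alpha> j) = d l"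
    "(\<Sum>\<alpha>\<in>multi_indices m n. f \<alpha>) \<le> (4 * exp 1) ^ m * (\<Sum>\<alpha>\<in>A. f \<alpha>)"
proof -
  define S where "S \<alpha> = {j. j < n \<and> 0 < \<alpha> j}" for \<alpha> :: "nat \<Rightarrow> nat"
  obtain \<kappa> :: "nat \<Rightarrow> nat" where \<kappa>: "\<And>j. \<kappa> j < m"
    "exp (- real m) * (\<Sum>\<alpha>\<in>multi_indices m n. f \<alpha>)
      \<le> (\<Sum>\<alpha>\<in>{\<alpha>\<in>multi_indices m n. inj_on \<kappa> (S \<alpha>)}. f \<alpha>)"
    using exists_injective_colouring[of "multi_indices m n" f m S n] m f card_support_le
    unfolding S_def by blast
  define J where "J = {\<alpha>\<in>multi_indices m n. inj_on \<kappa> (S \<alpha>)}"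
  have J: "J \<subseteq> multi_indices m n" "finite J" by (auto simp: J_def)
  define D where "D \<alpha> l = (if l < m then \<Sum>j\<in>{j. j < n \<and> \<kappa> j = l}. \<alpha> j else 0)"
    for \<alpha> :: "nat \<Rightarrow> nat" and l
  have D: "D \<alpha> \<in> multi_indices m m" if "\<alpha> \<in> J" for \<alpha>
  proof -
    have "(\<Sum>l<m. \<Sum>j\<in>{j\<in>{..<n}. \<kappa> j = l}. \<alpha> j) = (\<Sum>j<n. \<alpha> j)"
      using \<kappa>(1) by (intro sum.group) auto
    then have "(\<Sum>l<m. D \<alpha> l) = m"
      using sum_multi_index[of \<alpha> m n] that J by (auto simp: D_def)
    then show ?thesis by (simp add: multi_indices_def D_def)
  qed
  have "0 < exp (- real m) * (\<Sum>\<alpha>\<in>multi_indices m n. f \<alpha>)" using pos by simp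
  then have sJ: "0 < sum f J" using \<kappa>(2) unfolding J_def by linarith
  then have "J \<noteq> {}" by auto
  obtain d where d: "d \<in> multi_indices m m"
    "sum f J \<le> real (card (multi_indices m m)) * (\<Sum>\<alpha>\<in>{\<alpha>\<in>J. D \<alpha> = d}. f \<alpha>)"
    by (rule exists_large_fibre[OF J(2) finite_multi_indices D \<open>J \<noteq> {}\<close>])
  define A where "A = {\<alpha>\<in>J. D \<alpha> = d \<and> 0 < f \<alpha>}"
  have A: "A \<subseteq> J" by (auto simp: A_def)
  have sA: "(\<Sum>\<alpha>\<in>{\<alpha>\<in>J. D \<alpha> = d}. f \<alpha>) = sum f A"
    using J(2) f by (intro sum.mono_neutral_right) (auto simp: A_def less_le)
  have card: "real (card (multi_indices m m)) \<le> 4 ^ m"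
  proof -
    have "real (card (multi_indices m m)) \<le> real (2 ^ (m + m))"
      using card_multi_indices_le_two_power of_nat_le_iff by blast
    also have "\<dots> = 4 ^ m" by (simp add: power_add power_mult_distrib[symmetric])
    finally show ?thesis .
  qed
  have "(\<Sum>\<alpha>\<in>multi_indices m n. f \<alpha>) \<le> exp m * sum f J"
    using \<kappa>(2) by (simp add: J_def exp_minus field_simps)
  also have "\<dots> \<le> exp m * (4 ^ m * sum f A)"
  proof -
    have "sum f J \<le> 4 ^ m * sum f A"
      using d(2) card f unfolding sA by (meson mult_right_mono order_trans sum_nonneg)
    then show ?thesis by simp
  qed
  also have "\<dots> = (4 * exp 1) ^ m * sum f A"
    by (simp add: power_mult_distrib exp_of_nat_mult[symmetric])
  finally have big: "(\<Sum>\<alpha>\<in>multi_indices m n. f \<alpha>) \<le> (4 * exp 1) ^ m * sum f A" .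
  show ?thesis
  proof (rule that)
    show "A \<subseteq> multi_indices m n" using A J by blast
    show "(\<Sum>j\<in>{j. j < n \<and> \<kappa> j = l}. \<alpha> j) = d l" if "\<alpha> \<in> A" "l < m" for \<alpha> l
    proof -
      have "D \<alpha> l = d l" using that(1) by (simp add: A_def)
      then show ?thesis using that(2) by (simp add: D_def)
    qed
    show "inj_on \<kappa> {j. j < n \<and> 0 < \<alpha> j}" if "\<alpha> \<in> A" for \<alpha>
      using that by (simp add: A_def J_def S_def)
    show "0 < f \<alpha>" if "\<alpha> \<in> A" for \<alpha> using that by (simp add: A_def)
  qed (fact \<kappa>(1) d(1) big)+
qed

text \<open>
  The weights from \<open>entropy_lower_bound\<close> are in the unit ball, so the form with coefficients
  \<open>b \<alpha> = a \<alpha> * w^\<alpha>\<close> is bounded on the torus by the norm of the original form, and \<open>aligned_lq_bound\<close>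
  applies to it. The base \<open>128 * e\<close> is \<open>4 * e\<close> from the choice of the colouring and the degrees, times
  \<open>32\<close> from the moments.
\<close>

theorem complex_coeff_norm_le:
  fixes a :: "(nat \<Rightarrow> nat) \<Rightarrow> complex"
  assumes m: "0 < m" and p: "real m < p" "p \<le> 2 * real m" and q: "q = p / (p - real m)"
  shows "hpoly_coeff_norm q m n a
    \<le> (128 * exp 1) powr (m / q) * real m powr (m / p) * hpoly_sup_norm (ereal p) m n a"
proof -
  have p0: "0 < p" and q2: "2 \<le> q" using p m by (auto simp: q field_simps)
  define K where "K = hpoly_sup_norm (ereal p) m n a"
  have K0: "0 \<le> K" using hpoly_sup_norm_nonneg[OF p0] by (simp add: K_def)
  define f where "f \<alpha> = norm (a \<alpha>) powr q" for \<alpha>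
  define R0 where "R0 = (\<Sum>\<alpha>\<in>multi_indices m n. f \<alpha>)"
  have norm_eq: "hpoly_coeff_norm q m n a = R0 powr (1 / q)"
    by (simp add: hpoly_coeff_norm_def R0_def f_def)
  have R0: "0 \<le> R0" by (simp add: R0_def f_def sum_nonneg)
  show ?thesis
  proof (cases "R0 = 0")
    case True
    then show ?thesis using K0 by (simp add: norm_eq K_def[symmetric])
  next
    case False
    then have pos: "0 < (\<Sum>\<alpha>\<in>multi_indices m n. f \<alpha>)" using R0 by (simp add: R0_def)
    have f_nonneg: "0 \<le> f \<alpha>" for \<alpha> by (simp add: f_def)
    obtain \<kappa> d :: "nat \<Rightarrow> nat" and A where
      A: "A \<subseteq> multi_indices m n" and \<kappa>: "\<And>j. \<kappa> j < m" and d: "d \<in> multi_indices m m"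
      and f_pos: "\<And>\<alpha>. \<alpha> \<in> A \<Longrightarrow> 0 < f \<alpha>"
      and inj: "\<And>\<alpha>. \<alpha> \<in> A \<Longrightarrow> inj_on \<kappa> {j. j < n \<and> 0 < \<alpha> j}"
      and deg: "\<And>\<alpha> l. \<alpha> \<in> A \<Longrightarrow> l < m \<Longrightarrow> (\<Sum>j\<in>{j. j < n \<and> \<kappa> j = l}. \<alpha> j) = d l"
      and big: "(\<Sum>\<alpha>\<in>multi_indices m n. f \<alpha>) \<le> (4 * exp 1) ^ m * (\<Sum>\<alpha>\<in>A. f \<alpha>)"
      by (rule exists_homogeneous_colouring[OF m f_nonneg pos]) blast
    have fA: "finite A" using A finite_subset by blast
    define R where "R = sum f A"
    have bigR: "R0 \<le> (4 * exp 1) ^ m * R" using big by (simp add: R0_def R_def)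
    then have "0 < (4 * exp 1) ^ m * R" using False R0 by linarith
    then have R: "0 < R" by (rule zero_less_mult_pos) simp
    define \<phi> where "\<phi> \<alpha> = f \<alpha> / R" for \<alpha>
    have \<phi>_pos: "0 < \<phi> \<alpha>" if "\<alpha> \<in> A" for \<alpha> using f_pos[OF that] R by (simp add: \<phi>_def)
    have \<phi>_sum: "sum \<phi> A = 1"
      using R by (simp add: \<phi>_def sum_divide_distrib[symmetric] R_def[symmetric])
    obtain w :: "nat \<Rightarrow> real" and l where w: "\<And>j. 0 \<le> w j" "(\<Sum>j<n. w j powr p) \<le> 1"
      and l: "l < m" "0 < d l" and lower: "real m powr (- (m / p)) \<le>
      (\<Sum>j\<in>{j. j < n \<and> \<kappa> j = l}.
        (\<Sum>\<alpha>\<in>{\<alpha>\<in>A. 0 < \<alpha> j}. \<phi> \<alpha> * zpow n w \<alpha> powr q) powr (1 / q))"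
      using entropy_lower_bound[OF A m \<phi>_pos \<phi>_sum \<kappa> deg inj p(1) q] by blast
    define V where "V = {j. j < n \<and> \<kappa> j = l}"
    define b where "b \<alpha> = a \<alpha> * of_real (zpow n w \<alpha>)" for \<alpha>
    have bound: "norm (\<Sum>\<alpha>\<in>multi_indices m n. b \<alpha> * zpow n z \<alpha>) \<le> K" if z: "z \<in> torus n" for z
    proof -
      have "(\<Sum>\<alpha>\<in>multi_indices m n. b \<alpha> * zpow n z \<alpha>) = hpoly_eval m n a (\<lambda>j. of_real (w j) * z j)"
        by (simp add: hpoly_eval_def b_def power_mult_distrib prod.distrib mult.assoc)
      moreover have "lp_norm (ereal p) n (\<lambda>j. of_real (w j) * z j) \<le> 1"
        using w z by (simp add: lp_norm_le_one_iff[OF p0] norm_mult torus_def)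
      ultimately show ?thesis unfolding K_def using hpoly_eval_le_sup_norm[OF p0] by metis
    qed
    have dl: "d l \<le> m" using multi_indices_le[OF d] .
    have "real m powr (- (m / p)) * R powr (1 / q)
        \<le> (\<Sum>j\<in>V. (\<Sum>\<alpha>\<in>{\<alpha>\<in>A. 0 < \<alpha> j}. \<phi> \<alpha> * zpow n w \<alpha> powr q) powr (1 / q)) * R powr (1 / q)"
      using lower by (intro mult_right_mono) (auto simp: V_def)
    also have "\<dots> = (\<Sum>j\<in>V. (\<Sum>\<alpha>\<in>{\<alpha>\<in>A. 0 < \<alpha> j}. norm (b \<alpha>) powr q) powr (1 / q))"
      unfolding sum_distrib_right
    proof (rule sum.cong[OF refl])
      fix j
      have "(\<Sum>\<alpha>\<in>{\<alpha>\<in>A. 0 < \<alpha> j}. norm (b \<alpha>) powr q)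
          = (\<Sum>\<alpha>\<in>{\<alpha>\<in>A. 0 < \<alpha> j}. \<phi> \<alpha> * zpow n w \<alpha> powr q) * R"
        unfolding sum_distrib_right
      proof (intro sum.cong refl)
        fix \<alpha>
        have "0 \<le> zpow n w \<alpha>" using w(1) by (intro prod_nonneg) auto
        then show "norm (b \<alpha>) powr q = \<phi> \<alpha> * zpow n w \<alpha> powr q * R"
          using R by (simp only: b_def norm_mult norm_of_real powr_mult abs_of_nonneg norm_ge_zero)
            (simp add: \<phi>_def f_def)
      qed
      moreover have "0 \<le> (\<Sum>\<alpha>\<in>{\<alpha>\<in>A. 0 < \<alpha> j}. \<phi> \<alpha> * zpow n w \<alpha> powr q)"
        using \<phi>_pos by (intro sum_nonneg mult_nonneg_nonneg) (auto intro: less_imp_le)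
      ultimately show "(\<Sum>\<alpha>\<in>{\<alpha>\<in>A. 0 < \<alpha> j}. \<phi> \<alpha> * zpow n w \<alpha> powr q) powr (1 / q) * R powr (1 / q)
          = (\<Sum>\<alpha>\<in>{\<alpha>\<in>A. 0 < \<alpha> j}. norm (b \<alpha>) powr q) powr (1 / q)"
        using R by (simp add: powr_mult)
    qed
    also have "\<dots> \<le> (\<Sum>j\<in>V. (\<Sum>\<alpha>\<in>block_slice m n V (d l) j. norm (b \<alpha>) powr q) powr (1 / q))"
    proof (rule sum_mono)
      fix j assume j: "j \<in> V"
      then have j': "j < n" "\<kappa> j = l" by (auto simp: V_def)
      have "{\<alpha>\<in>A. 0 < \<alpha> j} \<subseteq> block_slice m n V (d l) j"
      proof
        fix \<alpha> assume "\<alpha> \<in> {\<alpha>\<in>A. 0 < \<alpha> j}"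
        then have \<alpha>: "\<alpha> \<in> A" "0 < \<alpha> j" by auto
        show "\<alpha> \<in> block_slice m n V (d l) j"
          using injective_colouring_block_slice[of \<alpha> m n \<kappa> j "d l"] \<alpha> j' A inj[OF \<alpha>(1)] deg[OF \<alpha>(1) l(1)]
          by (auto simp: V_def)
      qed
      then show "(\<Sum>\<alpha>\<in>{\<alpha>\<in>A. 0 < \<alpha> j}. norm (b \<alpha>) powr q) powr (1 / q)
          \<le> (\<Sum>\<alpha>\<in>block_slice m n V (d l) j. norm (b \<alpha>) powr q) powr (1 / q)"
        using q2 by (intro powr_mono2 sum_mono2) (auto intro: sum_nonneg)
    qed
    also have "\<dots> \<le> 32 powr (m / q) * K"
      using aligned_lq_bound[OF bound _ l(2) dl q2, of V] by (auto simp: V_def)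
    finally have "R powr (1 / q) \<le> 32 powr (m / q) * real m powr (m / p) * K"
      using m by (simp add: powr_minus field_simps)
    have "R0 powr (1 / q) \<le> ((4 * exp 1) ^ m * R) powr (1 / q)"
      using bigR R0 q2 by (intro powr_mono2) auto
    also have "\<dots> = (4 * exp 1) powr (m / q) * R powr (1 / q)"
      using R by (simp add: powr_mult powr_powr powr_realpow[symmetric])
    also have "\<dots> \<le> (4 * exp 1) powr (m / q) * (32 powr (m / q) * real m powr (m / p) * K)"
      using \<open>R powr (1 / q) \<le> _\<close> by (intro mult_left_mono) auto
    also have "\<dots> = (128 * exp 1) powr (m / q) * real m powr (m / p) * K"
    proof -
      have "(4 * exp 1) powr (m / q) * 32 powr (m / q) = (128 * exp 1 :: real) powr (m / q)"
        by (subst powr_mult[symmetric]) auto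
      then show ?thesis by simp
    qed
    finally show ?thesis by (simp add: norm_eq K_def)
  qed
qed

section \<open>The lower bound for complex forms\<close>

lemma prod_coordinates_le:
  fixes z :: "nat \<Rightarrow> 'k::real_normed_field"
  assumes m: "0 < m" and p: "0 < p" and z: "(\<Sum>j<m. norm (z j) powr p) \<le> 1"
  shows "norm (\<Prod>j<m. z j) \<le> real m powr (- (m / p))"
proof -
  have "(\<Prod>j<m. norm (z j) powr p) powr (1 / m) \<le> (\<Sum>j<m. norm (z j) powr p / m)"
    using arith_geom_mean[of "{..<m}" "\<lambda>j. norm (z j) powr p"] m by auto
  also have "\<dots> \<le> 1 / m"
    unfolding sum_divide_distrib[symmetric] using z by (intro divide_right_mono) auto
  finally have le: "(\<Prod>j<m. norm (z j) powr p) powr (1 / m) \<le> 1 / m" .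
  have eq: "(\<Prod>j<m. norm (z j) powr p) = (\<Prod>j<m. norm (z j)) powr p"
    by (rule prod_powr_distrib[symmetric])
  have P0: "0 \<le> (\<Prod>j<m. norm (z j))" by (intro prod_nonneg) auto
  have "(\<Prod>j<m. norm (z j)) = ((\<Prod>j<m. norm (z j)) powr (p / m)) powr (m / p)"
    using m p P0 by (simp add: powr_powr)
  also have "\<dots> \<le> (1 / m) powr (m / p)"
    using le p unfolding eq by (intro powr_mono2) (auto simp: powr_powr)
  also have "\<dots> = real m powr (- (m / p))"
    by (simp add: powr_divide powr_minus_divide)
  finally show ?thesis by (simp add: prod_norm)
qed

lemma coeff_norm_ge_coeff:
  assumes "\<alpha> \<in> multi_indices m n" "0 < q"
  shows "norm (a \<alpha>) \<le> hpoly_coeff_norm q m n a"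
proof -
  have "norm (a \<alpha>) powr q \<le> (\<Sum>\<alpha>\<in>multi_indices m n. norm (a \<alpha>) powr q)"
    using assms(1) by (intro member_le_sum) auto
  then have "(norm (a \<alpha>) powr q) powr (1 / q) \<le> hpoly_coeff_norm q m n a"
    unfolding hpoly_coeff_norm_def using assms(2) by (intro powr_mono2) auto
  then show ?thesis using assms(2) by (simp add: powr_powr)
qed

text \<open>
  The form \<open>z_1 \<cdots> z_m\<close> has coefficient norm \<open>1\<close> for every exponent, and its maximum on
  the unit ball is given by the inequality of the means.
\<close>

lemma HL_bound_ge_power:
  assumes m: "0 < m" and p: "real m < p" "p < 2 * real m"
    and C: "HL_bound (K :: 'k::real_normed_field itself) m (ereal p) C"
  shows "real m powr (m / p) \<le> C"
proof -
  have p0: "0 < p" using p(1) by linarith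
  define \<alpha>1 where "\<alpha>1 j = (if j < m then 1 else 0 :: nat)" for j
  define a :: "(nat \<Rightarrow> nat) \<Rightarrow> 'k" where "a \<alpha> = (if \<alpha> = \<alpha>1 then 1 else 0)" for \<alpha>
  have \<alpha>1: "\<alpha>1 \<in> multi_indices m m" by (simp add: multi_indices_def \<alpha>1_def)
  have ev: "hpoly_eval m m a z = (\<Prod>j<m. z j)" for z
  proof -
    have "hpoly_eval m m a z = (\<Sum>\<alpha>\<in>multi_indices m m. if \<alpha> = \<alpha>1 then zpow m z \<alpha> else 0)"
      unfolding hpoly_eval_def by (intro sum.cong) (auto simp: a_def)
    also have "\<dots> = zpow m z \<alpha>1" using \<alpha>1 by simp
    also have "\<dots> = (\<Prod>j<m. z j)" by (simp add: \<alpha>1_def)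
    finally show ?thesis .
  qed
  have "1 \<le> hpoly_coeff_norm (HL_exponent m (ereal p)) m m a"
    using coeff_norm_ge_coeff[OF \<alpha>1, of "HL_exponent m (ereal p)" a] p p0
    by (simp add: HL_exponent_eq a_def)
  also have "\<dots> \<le> C * hpoly_sup_norm (ereal p) m m a"
    using C m by (simp add: HL_bound_def)
  finally have 1: "1 \<le> C * hpoly_sup_norm (ereal p) m m a" .
  have "hpoly_sup_norm (ereal p) m m a \<le> real m powr (- (m / p))"
    using prod_coordinates_le[OF m p0] by (intro hpoly_sup_norm_leI[OF p0])
      (simp add: ev lp_norm_le_one_iff[OF p0])
  moreover have "0 \<le> hpoly_sup_norm (ereal p) m m a" by (rule hpoly_sup_norm_nonneg[OF p0])
  moreover have "0 < C"
    using 1 calculation(2) by (smt (verit) mult_nonneg_nonneg mult_nonpos_nonneg)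
  ultimately have "1 \<le> C * real m powr (- (m / p))"
    using 1 by (meson less_imp_le mult_left_mono order_trans)
  then show ?thesis using m by (simp add: powr_minus field_simps)
qed

lemma HL_bound_complex:
  assumes m: "0 < m" and p: "real m < p" "p < 2 * real m"
  shows "HL_bound TYPE(complex) m (ereal p)
    ((128 * exp 1) powr (m * (p - m) / p) * real m powr (m / p))"
proof -
  have "real m / (p / (p - m)) = m * (p - m) / p" using p by (simp add: field_simps)
  then show ?thesis
    using complex_coeff_norm_le[OF m p(1) _ refl] p(2)
    unfolding HL_bound_def HL_exponent_eq[OF p] by auto
qed

section \<open>Complexification of real forms\<close>

text \<open>
  For \<open>\<zeta> = \<theta> ^ 2\<close> with \<open>|\<theta>| = 1\<close> the point \<open>z + \<zeta> * cnj z\<close> is \<open>2 * \<theta>\<close> times the real point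
  \<open>Re (cnj \<theta> * z)\<close>, which is again in the unit ball. So \<open>\<zeta> \<mapsto> P (z + \<zeta> * cnj z)\<close> is bounded by
  \<open>2 ^ m\<close> times the real norm on the unit circle, and the maximum principle carries this over to
  \<open>\<zeta> = 0\<close>.
\<close>

lemma complex_le_real_sup_norm:
  fixes a :: "(nat \<Rightarrow> nat) \<Rightarrow> real" and z :: "nat \<Rightarrow> complex"
  assumes p: "0 < p" and z: "lp_norm (ereal p) n z \<le> 1"
  shows "norm (hpoly_eval m n (\<lambda>\<alpha>. of_real (a \<alpha>)) z) \<le> 2 ^ m * hpoly_sup_norm (ereal p) m n a"
proof -
  define g where "g \<zeta> = hpoly_eval m n (\<lambda>\<alpha>. complex_of_real (a \<alpha>)) (\<lambda>j. z j + \<zeta> * cnj (z j))" for \<zeta>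
  have hol: "g holomorphic_on UNIV"
    unfolding g_def hpoly_eval_def by (intro holomorphic_intros)
  have bd: "norm (g \<zeta>) \<le> 2 ^ m * hpoly_sup_norm (ereal p) m n a" if "norm \<zeta> = 1" for \<zeta>
  proof -
    define \<theta> where "\<theta> = csqrt \<zeta>"
    have \<theta>: "\<theta> * \<theta> = \<zeta>" "norm \<theta> = 1"
      using that by (simp_all add: \<theta>_def power2_eq_square[symmetric] norm_csqrt)
    define x where "x j = Re (cnj \<theta> * z j)" for j
    have "z j + \<zeta> * cnj (z j) = \<theta> * 2 * of_real (x j)" for j
    proof -
      have "complex_of_real (2 * x j) = cnj \<theta> * z j + \<theta> * cnj (z j)"
        using complex_add_cnj[of "cnj \<theta> * z j"] by (simp add: x_def)
      moreover have "\<theta> * cnj \<theta> = 1" using \<theta>(2) by (simp add: complex_norm_square[symmetric])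
      ultimately show ?thesis using \<theta>(1) by (simp add: algebra_simps flip: \<theta>(1))
    qed
    then have "g \<zeta> = (\<Sum>\<alpha>\<in>multi_indices m n. (\<theta> * 2) ^ m * (of_real (a \<alpha>) * zpow n (\<lambda>j. of_real (x j)) \<alpha>))"
      unfolding g_def hpoly_eval_def
      by (intro sum.cong refl)
        (simp add: power_mult_distrib prod.distrib power_sum[symmetric] sum_multi_index)
    also have "\<dots> = (\<theta> * 2) ^ m * of_real (hpoly_eval m n a x)"
      by (simp add: sum_distrib_left hpoly_eval_def)
    finally have "norm (g \<zeta>) = 2 ^ m * norm (hpoly_eval m n a x)"
      using \<theta>(2) by (simp add: norm_mult norm_power)
    moreover have "norm (hpoly_eval m n a x) \<le> hpoly_sup_norm (ereal p) m n a"
    proof (rule hpoly_eval_le_sup_norm[OF p])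
      have "(\<Sum>j<n. norm (x j) powr p) \<le> (\<Sum>j<n. norm (z j) powr p)"
      proof (intro sum_mono powr_mono2)
        fix j
        show "norm (x j) \<le> norm (z j)"
          using abs_Re_le_cmod[of "cnj \<theta> * z j"] \<theta>(2) by (simp add: x_def norm_mult)
      qed (use p in auto)
      then show "lp_norm (ereal p) n x \<le> 1"
        using z by (simp add: lp_norm_le_one_iff[OF p])
    qed
    ultimately show ?thesis by simp
  qed
  have "norm (g 0) \<le> 2 ^ m * hpoly_sup_norm (ereal p) m n a"
  proof (rule maximum_modulus_frontier[where f = g and \<xi> = 0 and S = "ball (0::complex) 1"])
    show "g holomorphic_on interior (ball (0::complex) 1)" using hol holomorphic_on_subset by blast
    show "continuous_on (closure (ball (0::complex) 1)) g"
      by (rule continuous_on_subset[OF holomorphic_on_imp_continuous_on[OF hol] subset_UNIV])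
  qed (use bd in auto)
  then show ?thesis by (simp add: g_def)
qed

lemma HL_bound_real_of_complex:
  assumes m: "0 < m" and p: "0 < p" and C: "HL_bound TYPE(complex) m (ereal p) C" "0 \<le> C"
  shows "HL_bound TYPE(real) m (ereal p) (2 ^ m * C)"
  unfolding HL_bound_def
proof (intro allI impI)
  fix n and a :: "(nat \<Rightarrow> nat) \<Rightarrow> real" assume n: "1 \<le> (n::nat)"
  have "hpoly_coeff_norm (HL_exponent m (ereal p)) m n a
      = hpoly_coeff_norm (HL_exponent m (ereal p)) m n (\<lambda>\<alpha>. complex_of_real (a \<alpha>))"
    by (simp add: hpoly_coeff_norm_def)
  also have "\<dots> \<le> C * hpoly_sup_norm (ereal p) m n (\<lambda>\<alpha>. complex_of_real (a \<alpha>))"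
    using C(1) n by (simp add: HL_bound_def)
  also have "\<dots> \<le> C * (2 ^ m * hpoly_sup_norm (ereal p) m n a)"
    using C(2) complex_le_real_sup_norm[OF p]
    by (intro mult_left_mono hpoly_sup_norm_leI[OF p]) auto
  finally show "hpoly_coeff_norm (HL_exponent m (ereal p)) m n a
      \<le> 2 ^ m * C * hpoly_sup_norm (ereal p) m n a" by (simp add: mult_ac)
qed

section \<open>Real forms with large complex values\<close>

text \<open>
  The functions \<open>F\<close> and \<open>G\<close> are the values of one form with real coefficients on real and on complex
  points. They are tracked together because the lower bound for the real constant plays them off
  against each other.
\<close>

definition is_real_form :: "nat \<Rightarrow> nat \<Rightarrow> ((nat \<Rightarrow> real) \<Rightarrow> real) \<Rightarrow> ((nat \<Rightarrow> complex) \<Rightarrow> complex) \<Rightarrow> bool" where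
  "is_real_form m n F G \<longleftrightarrow> (\<exists>a. (\<forall>x. F x = hpoly_eval m n a x) \<and>
     (\<forall>z. G z = hpoly_eval m n (\<lambda>\<alpha>. of_real (a \<alpha>)) z))"

lemma is_real_formI:
  fixes c :: "'i \<Rightarrow> real"
  assumes "finite I" "\<And>i. i \<in> I \<Longrightarrow> \<beta> i \<in> multi_indices m n"
    and "\<And>x. F x = (\<Sum>i\<in>I. c i * zpow n x (\<beta> i))"
    and "\<And>z. G z = (\<Sum>i\<in>I. of_real (c i) * zpow n z (\<beta> i))"
  shows "is_real_form m n F G"
  unfolding is_real_form_def
proof (intro exI[of _ "\<lambda>\<alpha>. \<Sum>i\<in>{i\<in>I. \<beta> i = \<alpha>}. c i"] conjI allI)
  show "F x = hpoly_eval m n (\<lambda>\<alpha>. \<Sum>i\<in>{i\<in>I. \<beta> i = \<alpha>}. c i) x" for x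
    unfolding assms(3) by (rule sum_monomials_eq_hpoly_eval[OF assms(1,2)])
  show "G z = hpoly_eval m n (\<lambda>\<alpha>. of_real (\<Sum>i\<in>{i\<in>I. \<beta> i = \<alpha>}. c i)) z" for z
    unfolding assms(4) of_real_sum by (rule sum_monomials_eq_hpoly_eval[OF assms(1,2)])
qed

lemma is_real_form_coordinate:
  assumes "i < n"
  shows "is_real_form 1 n (\<lambda>x. x i) (\<lambda>z. z i)"
proof -
  have *: "zpow n y (\<lambda>j. if j = i then 1 else 0) = y i" for y :: "nat \<Rightarrow> 'a::comm_ring_1"
  proof -
    have "zpow n y (\<lambda>j. if j = i then 1 else 0) = (\<Prod>j<n. if j = i then y j else 1)"
      by (intro prod.cong) auto
    then show ?thesis using assms by simp
  qed
  show ?thesis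
  proof (rule is_real_formI[of "{()}" "\<lambda>_ j. if j = i then 1 else 0" _ _ _ "\<lambda>_. 1"])
    show "(\<lambda>j. if j = i then 1 else 0) \<in> multi_indices 1 n"
      using assms by (simp add: multi_indices_def)
  qed (simp_all only: * sum.insert_if sum.empty finite.emptyI finite.insertI empty_iff if_False
      add_0_right mult_1 of_real_1)
qed

lemma is_real_form_diff:
  assumes "is_real_form m n F G" "is_real_form m n F' G'"
  shows "is_real_form m n (\<lambda>x. F x - F' x) (\<lambda>z. G z - G' z)"
proof -
  obtain a a' where "\<And>x. F x = hpoly_eval m n a x" "\<And>z. G z = hpoly_eval m n (\<lambda>\<alpha>. of_real (a \<alpha>)) z"
    "\<And>x. F' x = hpoly_eval m n a' x" "\<And>z. G' z = hpoly_eval m n (\<lambda>\<alpha>. of_real (a' \<alpha>)) z"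
    using assms unfolding is_real_form_def by blast
  then show ?thesis unfolding is_real_form_def
    by (intro exI[of _ "\<lambda>\<alpha>. a \<alpha> - a' \<alpha>"])
      (simp add: hpoly_eval_def left_diff_distrib sum_subtractf)
qed

lemma is_real_form_mult:
  assumes "is_real_form m n F G" "is_real_form m' n F' G'"
  shows "is_real_form (m + m') n (\<lambda>x. F x * F' x) (\<lambda>z. G z * G' z)"
proof -
  obtain a a' where *: "\<And>x. F x = hpoly_eval m n a x" "\<And>z. G z = hpoly_eval m n (\<lambda>\<alpha>. of_real (a \<alpha>)) z"
    "\<And>x. F' x = hpoly_eval m' n a' x" "\<And>z. G' z = hpoly_eval m' n (\<lambda>\<alpha>. of_real (a' \<alpha>)) z"
    using assms unfolding is_real_form_def by blast
  show ?thesis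
  proof (rule is_real_formI[of "multi_indices m n \<times> multi_indices m' n"
      "\<lambda>x j. fst x j + snd x j" _ _ _ "\<lambda>x. a (fst x) * a' (snd x)"])
    show "(\<lambda>j. fst x j + snd x j) \<in> multi_indices (m + m') n"
      if "x \<in> multi_indices m n \<times> multi_indices m' n" for x
      using that by (auto simp: multi_indices_def sum.distrib)
    show "F x * F' x = (\<Sum>y\<in>multi_indices m n \<times> multi_indices m' n.
        a (fst y) * a' (snd y) * zpow n x (\<lambda>j. fst y j + snd y j))" for x
      unfolding * hpoly_eval_def sum_product sum.cartesian_product
      by (intro sum.cong refl) (simp add: case_prod_unfold power_add prod.distrib mult_ac)
    show "G z * G' z = (\<Sum>y\<in>multi_indices m n \<times> multi_indices m' n.
        of_real (a (fst y) * a' (snd y)) * zpow n z (\<lambda>j. fst y j + snd y j))" for z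
      unfolding * hpoly_eval_def sum_product sum.cartesian_product
      by (intro sum.cong refl) (simp add: case_prod_unfold power_add prod.distrib mult_ac)
  qed auto
qed

lemma is_real_form_power:
  assumes "is_real_form m n F G"
  shows "is_real_form (k * m) n (\<lambda>x. F x ^ k) (\<lambda>z. G z ^ k)"
proof (induction k)
  case 0
  show ?case
    by (rule is_real_formI[of "{()}" "\<lambda>_ _. 0" _ _ _ "\<lambda>_. 1"]) (auto simp: multi_indices_def)
next
  case (Suc k)
  then show ?case using is_real_form_mult[OF assms Suc] by (simp add: add.commute)
qed

text \<open>
  The form of degree \<open>2 ^ k\<close> in the variables \<open>i, \<dots>, i + 2 ^ k - 1\<close> that arises by iterating \<open>x^2 - y^2\<close> on
  disjoint groups of variables.
\<close>

fun diff_squares :: "nat \<Rightarrow> nat \<Rightarrow> (nat \<Rightarrow> 'a::comm_ring_1) \<Rightarrow> 'a" where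
  "diff_squares 0 i x = x i"
| "diff_squares (Suc k) i x = diff_squares k i x ^ 2 - diff_squares k (i + 2 ^ k) x ^ 2"

lemma is_real_form_diff_squares:
  "i + 2 ^ k \<le> n \<Longrightarrow> is_real_form (2 ^ k) n (diff_squares k i) (diff_squares k i)"
proof (induction k arbitrary: i)
  case 0
  then show ?case using is_real_form_coordinate[of i n] by simp
next
  case (Suc k)
  have "is_real_form (2 * 2 ^ k) n (\<lambda>x. diff_squares k i x ^ 2 - diff_squares k (i + 2 ^ k) x ^ 2)
      (\<lambda>x. diff_squares k i x ^ 2 - diff_squares k (i + 2 ^ k) x ^ 2)"
    using Suc.prems by (intro is_real_form_diff is_real_form_power Suc.IH) auto
  then show ?case by simp
qed

lemma diff_squares_cong:
  "(\<And>j. i \<le> j \<Longrightarrow> j < i + 2 ^ k \<Longrightarrow> x j = y j) \<Longrightarrow> diff_squares k i x = diff_squares k i y"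
proof (induction k arbitrary: i)
  case (Suc k)
  have "diff_squares k i x = diff_squares k i y" by (rule Suc.IH) (use Suc.prems in auto)
  moreover have "diff_squares k (i + 2 ^ k) x = diff_squares k (i + 2 ^ k) y"
    by (rule Suc.IH) (use Suc.prems in auto)
  ultimately show ?case by simp
qed auto

text \<open>
  A difference of two numbers in the unit interval lies between \<open>-1\<close> and \<open>1\<close>.
\<close>

lemma abs_diff_squares_le_one:
  fixes x :: "nat \<Rightarrow> real"
  assumes "\<And>j. i \<le> j \<Longrightarrow> j < i + 2 ^ k \<Longrightarrow> \<bar>x j\<bar> \<le> 1"
  shows "\<bar>diff_squares k i x\<bar> \<le> 1"
  using assms
proof (induction k arbitrary: i)
  case (Suc k)
  have "\<bar>diff_squares k i x\<bar> \<le> 1" "\<bar>diff_squares k (i + 2 ^ k) x\<bar> \<le> 1"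
    using Suc.prems by (auto intro!: Suc.IH)
  then have "diff_squares k i x ^ 2 \<le> 1" "diff_squares k (i + 2 ^ k) x ^ 2 \<le> 1"
    by (simp_all add: abs_square_le_1)
  moreover have "0 \<le> diff_squares k i x ^ 2" "0 \<le> diff_squares k (i + 2 ^ k) x ^ 2" by simp_all
  ultimately show ?case by (simp only: diff_squares.simps abs_le_iff) linarith
qed auto

text \<open>
  On the torus the two squares can be given opposite phases, so that the modulus is squared and
  doubled at each step. For the induction any phase \<open>u\<close> has to be attainable: the two halves get the
  phases \<open>csqrt u\<close> and \<open>csqrt (- u)\<close>.
\<close>

lemma diff_squares_complex_value:
  assumes "norm u = 1"
  obtains z :: "nat \<Rightarrow> complex" where "\<And>j. norm (z j) = 1" "diff_squares k i z = u * 2 ^ (2 ^ k - 1)"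
proof -
  have "\<exists>z :: nat \<Rightarrow> complex. (\<forall>j. norm (z j) = 1) \<and> diff_squares k i z = u * 2 ^ (2 ^ k - 1)"
    using assms
  proof (induction k arbitrary: i u)
    case 0
    then show ?case by (intro exI[of _ "\<lambda>_. u"]) simp
  next
    case (Suc k)
    let ?c = "2 ^ (2 ^ k - 1) :: complex"
    obtain z1 where z1: "\<And>j. norm (z1 j) = 1" "diff_squares k i z1 = csqrt u * ?c"
      using Suc.IH[of "csqrt u" i] Suc.prems by (auto simp: norm_csqrt)
    obtain z2 where z2: "\<And>j. norm (z2 j) = 1"
      "diff_squares k (i + 2 ^ k) z2 = csqrt (- u) * ?c"
      using Suc.IH[of "csqrt (- u)" "i + 2 ^ k"] Suc.prems by (auto simp: norm_csqrt)
    define z where "z j = (if j < i + 2 ^ k then z1 j else z2 j)" for j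
    have "diff_squares k i z = diff_squares k i z1"
      by (rule diff_squares_cong) (simp add: z_def)
    moreover have "diff_squares k (i + 2 ^ k) z = diff_squares k (i + 2 ^ k) z2"
      by (rule diff_squares_cong) (simp add: z_def)
    ultimately have "diff_squares (Suc k) i z = 2 * u * ?c ^ 2"
      by (simp add: z1(2) z2(2) power_mult_distrib)
    also have "\<dots> = u * 2 ^ (2 ^ Suc k - 1)"
    proof -
      obtain c where "(2::nat) ^ k = Suc c" using not0_implies_Suc[of "2 ^ k :: nat"] by auto
      then have "2 ^ Suc k - 1 = Suc ((2 ^ k - 1) * 2 :: nat)" by simp
      then have "(2 :: complex) ^ (2 ^ Suc k - 1) = 2 * ?c ^ 2"
        by (simp only: power_Suc power_mult)
      then show ?thesis by simp
    qed
    finally have "diff_squares (Suc k) i z = u * 2 ^ (2 ^ Suc k - 1)" .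
    moreover have "norm (z j) = 1" for j using z1(1) z2(1) by (simp add: z_def)
    ultimately show ?case by blast
  qed
  then show ?thesis using that by blast
qed

text \<open>
  Test the inequality on \<open>diff_squares k 0 ^ N * x_0 ^ r\<close> with \<open>m = 2 ^ k * N + r\<close>. It is bounded by \<open>1\<close>
  on the real unit ball, and its large value on the torus is at most the sum of the moduli of its
  at most \<open>(m + 1) ^ 2 ^ k\<close> coefficients.
\<close>

lemma HL_bound_real_ge:
  assumes m: "0 < m" and p: "real m < p" "p < 2 * real m" and C: "HL_bound TYPE(real) m (ereal p) C"
  shows "2 ^ ((2 ^ k - 1) * (m div 2 ^ k)) \<le> real ((m + 1) ^ 2 ^ k) * C"
proof -
  have p0: "0 < p" using p(1) by linarith
  define n :: nat where "n = 2 ^ k"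
  define N where "N = m div 2 ^ k"
  define r where "r = m mod 2 ^ k"
  have mN: "N * 2 ^ k + r * 1 = m" by (simp add: N_def r_def div_mult_mod_eq)
  have n1: "0 < n" by (simp add: n_def)
  define q where "q = HL_exponent m (ereal p)"
  have q0: "0 < q" using p p0 by (simp add: q_def HL_exponent_eq)
  have "is_real_form m n (\<lambda>x. diff_squares k 0 x ^ N * x 0 ^ r) (\<lambda>z. diff_squares k 0 z ^ N * z 0 ^ r)"
    using is_real_form_mult[OF is_real_form_power[OF is_real_form_diff_squares[of 0 k n], of N]
        is_real_form_power[OF is_real_form_coordinate[OF n1], of r]]
    unfolding mN by (simp add: n_def)
  then obtain a :: "(nat \<Rightarrow> nat) \<Rightarrow> real"
    where F: "\<And>x. diff_squares k 0 x ^ N * x 0 ^ r = hpoly_eval m n a x"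
      and G: "\<And>z. diff_squares k 0 z ^ N * z 0 ^ r = hpoly_eval m n (\<lambda>\<alpha>. complex_of_real (a \<alpha>)) z"
    unfolding is_real_form_def by blast
  have sup: "hpoly_sup_norm (ereal p) m n a \<le> 1"
  proof (rule hpoly_sup_norm_leI[OF p0])
    fix x :: "nat \<Rightarrow> real" assume x: "lp_norm (ereal p) n x \<le> 1"
    then have le: "\<bar>x j\<bar> \<le> 1" if "j < n" for j
      using lp_norm_le_oneD[OF p0 x that] by simp
    have "\<bar>diff_squares k 0 x\<bar> \<le> 1" using le by (intro abs_diff_squares_le_one) (simp add: n_def)
    then have "\<bar>diff_squares k 0 x\<bar> ^ N * \<bar>x 0\<bar> ^ r \<le> 1"
      using le[OF n1] by (intro mult_le_one power_le_one) auto
    then show "norm (hpoly_eval m n a x) \<le> 1"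
      unfolding F[symmetric] by (simp add: abs_mult power_abs)
  qed
  have sup0: "0 \<le> hpoly_sup_norm (ereal p) m n a" by (rule hpoly_sup_norm_nonneg[OF p0])
  have coef: "hpoly_coeff_norm q m n a \<le> C * hpoly_sup_norm (ereal p) m n a"
    using C n1 by (simp add: HL_bound_def q_def)
  obtain z :: "nat \<Rightarrow> complex" where z: "\<And>j. norm (z j) = 1"
    "diff_squares k 0 z = 1 * 2 ^ (2 ^ k - 1)"
    using diff_squares_complex_value[of 1 k 0] by auto
  have "2 ^ ((2 ^ k - 1) * N) = norm (diff_squares k 0 z ^ N * z 0 ^ r)"
    using z by (simp add: norm_mult norm_power power_mult)
  also have "\<dots> \<le> (\<Sum>\<alpha>\<in>multi_indices m n. norm (complex_of_real (a \<alpha>)))"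
    unfolding G by (rule norm_hpoly_eval_le_sum) (simp add: z)
  also have "\<dots> \<le> (\<Sum>\<alpha>\<in>multi_indices m n. hpoly_coeff_norm q m n a)"
    using coeff_norm_ge_coeff[OF _ q0, of _ m n a] by (intro sum_mono) simp
  also have "\<dots> = real (card (multi_indices m n)) * hpoly_coeff_norm q m n a" by simp
  also have "\<dots> \<le> real ((m + 1) ^ n) * hpoly_coeff_norm q m n a"
    using card_multi_indices_le_power[of m n]
    by (intro mult_right_mono) (auto simp: hpoly_coeff_norm_def simp del: of_nat_power)
  finally have 1: "2 ^ ((2 ^ k - 1) * N) \<le> real ((m + 1) ^ n) * hpoly_coeff_norm q m n a" .
  have "hpoly_coeff_norm q m n a \<le> C"
  proof -
    have "0 < hpoly_coeff_norm q m n a"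
      using 1 by (smt (verit) mult_nonneg_nonpos of_nat_0_le_iff zero_less_power)
    then have "0 < C" using coef sup0 by (smt (verit) mult_nonpos_nonneg)
    then show ?thesis using coef sup by (smt (verit) mult_left_le)
  qed
  then show ?thesis
    using 1 unfolding N_def n_def by (meson mult_left_mono of_nat_0_le_iff order_trans)
qed

section \<open>Asymptotics of the constants\<close>

text \<open>
  The logarithm of the base in \<open>complex_coeff_norm_le\<close>.
\<close>

definition HL_rate :: real where
  "HL_rate = ln (128 * exp 1)"

lemma HL_rate_ge_one: "1 \<le> HL_rate"
  unfolding HL_rate_def by (subst ln_mult) auto

text \<open>
  Both estimates come from \<open>m powr (m / s)\<close>. As \<open>ln m \<le> s\<close>, it differs from \<open>m\<close> by a factor of at most
  \<open>exp (s - m)\<close>.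
\<close>

lemma H_pol_complex_bounds:
  assumes m: "0 < m" and s: "real m < s" "s < 2 * real m"
  defines "H \<equiv> H_pol TYPE(complex) m (ereal s)"
  shows "real m * exp (- (HL_rate * (s - m))) \<le> H" "H \<le> real m * exp (HL_rate * (s - m))" "1 \<le> H"
    "HL_bound TYPE(complex) m (ereal s) H"
proof -
  have s0: "0 < s" using s(1) by linarith
  note att = H_pol_attained[OF s0 HL_bound_complex[OF m s]]
  show "HL_bound TYPE(complex) m (ereal s) H" using att(1) by (simp add: H_def)
  have lower: "real m powr (m / s) \<le> H"
    unfolding H_def by (rule HL_bound_ge_power[OF m s att(1)])
  have "1 \<le> real m powr (m / s)" using m s0 by (intro ge_one_powr_ge_zero) auto
  then show "1 \<le> H" using lower by linarith
  have "ln m \<le> s" using ln_le_minus_one[of m] m s(1) by linarith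
  then have "ln m / s \<le> 1" using s0 by simp
  then have "ln m / s \<le> HL_rate" using HL_rate_ge_one by linarith
  then have "ln m / s * (s - m) \<le> HL_rate * (s - m)" using s by (intro mult_right_mono) auto
  then have "real m * exp (- (HL_rate * (s - m))) \<le> real m * exp (- (ln m / s * (s - m)))"
    by (intro mult_left_mono) auto
  also have "\<dots> = exp (ln m + - (ln m / s * (s - m)))"
    using m by (simp only: exp_add exp_ln of_nat_0_less_iff)
  also have "ln m + - (ln m / s * (s - m)) = m / s * ln m" using s0 by (simp add: field_simps)
  also have "exp (m / s * ln m) = real m powr (m / s)" using m by (simp add: powr_def)
  finally show "real m * exp (- (HL_rate * (s - m))) \<le> H" using lower by linarith
  have "H \<le> (128 * exp 1) powr (m * (s - m) / s) * real m powr (m / s)"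
    using att(2) by (simp add: H_def)
  also have "\<dots> \<le> exp (HL_rate * (s - m)) * real m powr 1"
  proof (intro mult_mono)
    have "m / s * (s - m) \<le> 1 * (s - m)" using s s0 by (intro mult_right_mono) auto
    then have "m * (s - m) / s \<le> s - m" by simp
    then have "m * (s - m) / s * HL_rate \<le> (s - m) * HL_rate"
      using HL_rate_ge_one by (intro mult_right_mono) auto
    then show "(128 * exp 1) powr (m * (s - m) / s) \<le> exp (HL_rate * (s - m))"
      by (simp add: powr_def HL_rate_def mult_ac)
    show "real m powr (m / s) \<le> real m powr 1" using m s s0 by (intro powr_mono) auto
  qed auto
  finally show "H \<le> real m * exp (HL_rate * (s - m))" using m by (simp add: mult.commute)
qed

lemma H_pol_real_bounds:
  assumes m: "0 < m" and s: "real m < s" "s < 2 * real m"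
  defines "H \<equiv> H_pol TYPE(real) m (ereal s)"
  shows "H \<le> 2 ^ m * (real m * exp (HL_rate * (s - m)))"
    "2 ^ ((2 ^ k - 1) * (m div 2 ^ k)) \<le> real ((m + 1) ^ 2 ^ k) * H" "0 < H"
proof -
  have s0: "0 < s" using s(1) by linarith
  let ?C = "H_pol TYPE(complex) m (ereal s)"
  have C: "1 \<le> ?C" "?C \<le> real m * exp (HL_rate * (s - m))" "HL_bound TYPE(complex) m (ereal s) ?C"
    using H_pol_complex_bounds[OF m s] by auto
  have "HL_bound TYPE(real) m (ereal s) (2 ^ m * ?C)"
    using C by (intro HL_bound_real_of_complex[OF m s0]) auto
  note att = H_pol_attained[OF s0 this]
  show "H \<le> 2 ^ m * (real m * exp (HL_rate * (s - m)))"
    using att(2) C(2) unfolding H_def by (smt (verit) mult_left_mono zero_le_power)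
  show "2 ^ ((2 ^ k - 1) * (m div 2 ^ k)) \<le> real ((m + 1) ^ 2 ^ k) * H"
    unfolding H_def by (rule HL_bound_real_ge[OF m s att(1)])
  have "0 < real m powr (m / s)" using m by simp
  also have "\<dots> \<le> H" unfolding H_def by (rule HL_bound_ge_power[OF m s att(1)])
  finally show "0 < H" .
qed

lemma root_of_upper_bound_uniform:
  assumes "0 < \<epsilon>"
  obtains \<delta> where "0 < \<delta>" "\<delta> < 1" "\<forall>\<^sub>F m in sequentially. \<forall>s. s \<le> real m + \<delta> * real m \<longrightarrow>
    (real m * exp (HL_rate * (s - m))) powr (1 / real m) < 1 + \<epsilon>"
proof -
  define \<eta> where "\<eta> = ln (1 + \<epsilon>) / 2"
  have \<eta>: "0 < \<eta>" using assms by (simp add: \<eta>_def)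
  define \<delta> where "\<delta> = min (1/2) (\<eta> / HL_rate)"
  have \<delta>: "0 < \<delta>" "\<delta> < 1" "HL_rate * \<delta> \<le> \<eta>"
    using \<eta> HL_rate_ge_one by (auto simp: \<delta>_def min_def field_simps)
  have "(\<lambda>m. ln (real m) / real m) \<longlonglongrightarrow> 0" by real_asymp
  then have "\<forall>\<^sub>F m in sequentially. ln (real m) / real m < \<eta>" using \<eta> by (rule order_tendstoD(2))
  then have "\<forall>\<^sub>F m in sequentially. \<forall>s. s \<le> real m + \<delta> * real m \<longrightarrow>
    (real m * exp (HL_rate * (s - m))) powr (1 / real m) < 1 + \<epsilon>"
    using eventually_gt_at_top[of 0]
  proof eventually_elim
    case (elim m)
    show ?case
    proof (intro allI impI)
      fix s assume s: "s \<le> real m + \<delta> * real m"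
      have "(real m * exp (HL_rate * (s - m))) powr (1 / real m)
          = exp (ln (real m) / real m + HL_rate * (s - m) / real m)"
        using elim(2) by (simp add: powr_def ln_mult add_divide_distrib)
      also have "HL_rate * (s - m) / real m \<le> HL_rate * \<delta>"
      proof -
        have "HL_rate * (s - m) \<le> HL_rate * (\<delta> * real m)"
          using s HL_rate_ge_one by (intro mult_left_mono) auto
        then show ?thesis using elim(2) by (simp add: field_simps)
      qed
      then have "exp (ln (real m) / real m + HL_rate * (s - m) / real m) < exp (\<eta> + \<eta>)"
        using elim(1) \<delta>(3) by (intro iffD2[OF exp_less_cancel_iff]) linarith
      also have "exp (\<eta> + \<eta>) = 1 + \<epsilon>" using assms by (simp add: \<eta>_def)
      finally show "(real m * exp (HL_rate * (s - m))) powr (1 / real m) < 1 + \<epsilon>" .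
    qed
  qed
  then show ?thesis using that \<delta>(1,2) by blast
qed

text \<open>
  With \<open>d = 2 ^ k\<close> the test forms give \<open>2 powr (1 - 1 / d)\<close> in the limit; choose \<open>k\<close> large first, then \<open>m\<close>.
  The bound does not involve \<open>s\<close>.
\<close>

lemma H_pol_real_root_lower:
  assumes "c < 2"
  shows "\<forall>\<^sub>F m in sequentially. \<forall>s. real m < s \<and> s < 2 * real m \<longrightarrow>
    c < H_pol TYPE(real) m (ereal s) powr (1 / real m)"
proof -
  have "(\<lambda>k. 2 * exp (- (ln 2 / 2 ^ k))) \<longlonglongrightarrow> (2::real)" by real_asymp
  then have "\<forall>\<^sub>F k in sequentially. c < 2 * exp (- (ln 2 / 2 ^ k))" using assms by (rule order_tendstoD(1))
  then obtain k :: nat where k: "c < 2 * exp (- (ln 2 / 2 ^ k))" by (auto simp: eventually_sequentially)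
  define d where "d = (2::nat) ^ k"
  have d: "0 < d" by (simp add: d_def)
  define D where "D = real d"
  define g where "g m = 2 * exp (- (ln 2 * (1 / D + D / real m) + D * ln (real m + 1) / real m))" for m :: nat
  have "g \<longlonglongrightarrow> 2 * exp (- (ln 2 * (1 / D + 0) + D * 0))"
    unfolding g_def times_divide_eq_right[symmetric]
    by (intro tendsto_intros) real_asymp+
  then have "g \<longlonglongrightarrow> 2 * exp (- (ln 2 / 2 ^ k))" by (simp add: D_def d_def)
  then have "\<forall>\<^sub>F m in sequentially. c < g m" using k by (rule order_tendstoD(1))
  then show ?thesis using eventually_gt_at_top[of 0]
  proof eventually_elim
    case (elim m)
    show ?case
    proof (intro allI impI)
      fix s assume s: "real m < s \<and> s < 2 * real m"
      define H where "H = H_pol TYPE(real) m (ereal s)"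
      have H0: "0 < H" and ge: "2 ^ ((d - 1) * (m div d)) \<le> real ((m + 1) ^ d) * H"
        using H_pol_real_bounds(2,3)[OF elim(2), of s] s by (auto simp: H_def d_def)
      have "real m = D * real (m div d) + real (m mod d)"
        unfolding D_def of_nat_mult[symmetric] of_nat_add[symmetric] by simp
      moreover have "real (m mod d) \<le> D" using d by (simp add: D_def less_imp_le)
      ultimately have "real m / D - 1 \<le> real (m div d)"
        using d by (simp add: D_def field_simps)
      then have "(D - 1) * (real m / D - 1) \<le> (D - 1) * real (m div d)"
        using d by (intro mult_left_mono) (auto simp: D_def)
      moreover have "real m * (1 - (1 / D + D / real m)) \<le> (D - 1) * (real m / D - 1)"
        using d elim(2) by (simp add: D_def field_simps)
      moreover have "(D - 1) * real (m div d) = real ((d - 1) * (m div d))"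
        using d by (simp add: D_def of_nat_diff)
      ultimately have e: "real m * (1 - (1 / D + D / real m)) \<le> real ((d - 1) * (m div d))" by linarith
      have "real ((d - 1) * (m div d)) * ln 2 = ln (2 ^ ((d - 1) * (m div d)))"
        by (simp add: ln_realpow)
      also have "\<dots> \<le> ln (real ((m + 1) ^ d) * H)"
        using ge H0 by (subst ln_le_cancel_iff) auto
      also have "\<dots> = D * ln (real m + 1) + ln H"
        using H0 by (simp add: ln_mult ln_realpow D_def add.commute)
      finally have "real m * (1 - (1 / D + D / real m)) * ln 2 \<le> D * ln (real m + 1) + ln H"
        using e by (smt (verit) ln_gt_zero mult_right_mono)
      then have "real m * ((1 - (1 / D + D / real m)) * ln 2 - D * ln (real m + 1) / real m) \<le> ln H"
        using elim(2) by (simp add: algebra_simps)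
      then have "(1 - (1 / D + D / real m)) * ln 2 - D * ln (real m + 1) / real m \<le> ln H / real m"
        using elim(2) by (simp add: pos_le_divide_eq mult.commute)
      then have "exp ((1 - (1 / D + D / real m)) * ln 2 - D * ln (real m + 1) / real m) \<le> exp (ln H / real m)"
        by simp
      moreover have "exp ((1 - (1 / D + D / real m)) * ln 2 - D * ln (real m + 1) / real m) = g m"
      proof -
        have "(1 - (1 / D + D / real m)) * ln 2 - D * ln (real m + 1) / real m
            = ln 2 + - (ln 2 * (1 / D + D / real m) + D * ln (real m + 1) / real m)"
          by (simp add: algebra_simps)
        then show ?thesis unfolding g_def by (simp only: exp_add) simp
      qed
      moreover have "exp (ln H / real m) = H powr (1 / real m)" using H0 by (simp add: powr_def)
      ultimately show "c < H_pol TYPE(real) m (ereal s) powr (1 / real m)"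
        using elim(1) by (simp add: H_def)
    qed
  qed
qed

text \<open>
  Uniformity in \<open>s\<close> is built in, so that limits along a sequence of exponents and suprema over
  ranges of exponents are read off in the same way.
\<close>

lemma H_pol_root_uniform:
  assumes "0 < \<epsilon>"
  obtains \<delta> where "0 < \<delta>" "\<forall>\<^sub>F m in sequentially. \<forall>s. real m < s \<and> s \<le> real m + \<delta> * real m \<longrightarrow>
    \<bar>H_pol TYPE(complex) m (ereal s) powr (1 / real m) - 1\<bar> < \<epsilon> \<and>
    \<bar>H_pol TYPE(real) m (ereal s) powr (1 / real m) - 2\<bar> < \<epsilon>"
proof -
  obtain \<delta> where \<delta>: "0 < \<delta>" "\<delta> < 1" "\<forall>\<^sub>F m in sequentially. \<forall>s. s \<le> real m + \<delta> * real m \<longrightarrow>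
    (real m * exp (HL_rate * (s - m))) powr (1 / real m) < 1 + \<epsilon> / 2"
    using root_of_upper_bound_uniform[of "\<epsilon> / 2"] assms by auto
  have "\<forall>\<^sub>F m in sequentially. \<forall>s. real m < s \<and> s < 2 * real m \<longrightarrow>
    2 - \<epsilon> < H_pol TYPE(real) m (ereal s) powr (1 / real m)"
    using assms by (intro H_pol_real_root_lower) simp
  with \<delta>(3) have "\<forall>\<^sub>F m in sequentially. \<forall>s. real m < s \<and> s \<le> real m + \<delta> * real m \<longrightarrow>
    \<bar>H_pol TYPE(complex) m (ereal s) powr (1 / real m) - 1\<bar> < \<epsilon> \<and>
    \<bar>H_pol TYPE(real) m (ereal s) powr (1 / real m) - 2\<bar> < \<epsilon>"
    using eventually_gt_at_top[of 0]
  proof eventually_elim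
    case (elim m)
    show ?case
    proof (intro allI impI)
      fix s assume s: "real m < s \<and> s \<le> real m + \<delta> * real m"
      have "\<delta> * real m < 1 * real m" using \<delta>(2) elim(3) by (intro mult_strict_right_mono) auto
      then have s2: "s < 2 * real m" using s by linarith
      note B = H_pol_real_bounds[OF elim(3) conjunct1[OF s] s2]
      define U where "U = (real m * exp (HL_rate * (s - m))) powr (1 / real m)"
      have U: "U < 1 + \<epsilon> / 2" using elim(1) s by (simp add: U_def)
      note A = H_pol_complex_bounds[OF elim(3) conjunct1[OF s] s2]
      have "1 powr (1 / real m) \<le> H_pol TYPE(complex) m (ereal s) powr (1 / real m)"
        using A(3) by (intro powr_mono2) auto
      then have C: "1 \<le> H_pol TYPE(complex) m (ereal s) powr (1 / real m)" by simp
      have C': "H_pol TYPE(complex) m (ereal s) powr (1 / real m) \<le> U"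
        unfolding U_def using A(2,3) by (intro powr_mono2) auto
      have "H_pol TYPE(real) m (ereal s) powr (1 / real m)
          \<le> (2 ^ m * (real m * exp (HL_rate * (s - m)))) powr (1 / real m)"
        using B(1,3) by (intro powr_mono2) auto
      also have "\<dots> = 2 * U"
        unfolding U_def using elim(3) by (subst powr_mult) (auto simp: powr_realpow[symmetric] powr_powr)
      finally have "H_pol TYPE(real) m (ereal s) powr (1 / real m) \<le> 2 * U" .
      moreover have "2 - \<epsilon> < H_pol TYPE(real) m (ereal s) powr (1 / real m)"
        using elim(2) s s2 by blast
      ultimately show "\<bar>H_pol TYPE(complex) m (ereal s) powr (1 / real m) - 1\<bar> < \<epsilon> \<and>
        \<bar>H_pol TYPE(real) m (ereal s) powr (1 / real m) - 2\<bar> < \<epsilon>"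
        using U C C' assms by (auto simp: abs_less_iff)
    qed
  qed
  then show ?thesis using that \<delta>(1) by blast
qed

lemma ereal_between_reals:
  assumes "ereal a < x" "x < ereal b"
  obtains s where "x = ereal s" "a < s" "s < b"
  using assms by (cases x) auto

lemma SUP_ereal_tendsto_zero:
  fixes g :: "nat \<Rightarrow> 'a \<Rightarrow> real"
  assumes small: "\<And>\<epsilon>. 0 < \<epsilon> \<Longrightarrow> \<forall>\<^sub>F m in sequentially. \<forall>s\<in>S m. g m s \<le> \<epsilon>"
    and ne: "\<forall>\<^sub>F m in sequentially. S m \<noteq> {}" and g0: "\<And>m s. 0 \<le> g m s"
  shows "(\<lambda>m. SUP s\<in>S m. ereal (g m s)) \<longlonglongrightarrow> 0"
proof (rule order_tendstoI)
  fix a :: ereal assume a: "a < 0"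
  show "\<forall>\<^sub>F m in sequentially. a < (SUP s\<in>S m. ereal (g m s))"
    using ne
  proof eventually_elim
    case (elim m)
    then obtain s where "s \<in> S m" by blast
    then have "ereal (g m s) \<le> (SUP s\<in>S m. ereal (g m s))" by (rule SUP_upper)
    moreover have "0 \<le> ereal (g m s)" using g0 by simp
    ultimately show ?case using a by (meson less_le_trans order_trans)
  qed
next
  fix a :: ereal assume "0 < a"
  then obtain \<epsilon> where \<epsilon>: "0 < \<epsilon>" "ereal \<epsilon> < a"
    using ereal_dense2[of 0 a] by (auto simp: zero_ereal_def)
  show "\<forall>\<^sub>F m in sequentially. (SUP s\<in>S m. ereal (g m s)) < a"
    using small[OF \<epsilon>(1)]
  proof eventually_elim
    case (elim m)
    then have "(SUP s\<in>S m. ereal (g m s)) \<le> ereal \<epsilon>" by (intro SUP_least) auto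
    then show ?case using \<epsilon>(2) by (rule le_less_trans)
  qed
qed

theorem theoremC:
  fixes p :: "nat \<Rightarrow> ereal"
  assumes p_gt: "\<forall>m\<ge>2. ereal (real m) < p m"
  shows
    "((\<lambda>m. p m / ereal (real m)) \<longlonglongrightarrow> 1 \<longrightarrow>
        (\<lambda>m. H_pol TYPE(complex) m (p m) powr (1 / real m)) \<longlonglongrightarrow> 1 \<and>
        (\<lambda>m. H_pol TYPE(real) m (p m) powr (1 / real m)) \<longlonglongrightarrow> 2)
   \<and> (\<forall>h :: nat \<Rightarrow> real. (\<forall>m\<ge>2. 0 < h m) \<and> (\<lambda>m. h m / real m) \<longlonglongrightarrow> 0 \<longrightarrow>
        (\<lambda>m. SUP s\<in>{ereal (real m)<..ereal (real m + h m)}.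
           ereal \<bar>H_pol TYPE(complex) m s powr (1 / real m) - 1\<bar>) \<longlonglongrightarrow> 0 \<and>
        (\<lambda>m. SUP s\<in>{ereal (real m)<..ereal (real m + h m)}.
           ereal \<bar>H_pol TYPE(real) m s powr (1 / real m) - 2\<bar>) \<longlonglongrightarrow> 0)
   \<and> ((\<lambda>m. (p m - ereal (real m)) / ereal (ln (real m))) \<longlonglongrightarrow> 0 \<longrightarrow>
        (\<exists>\<epsilon> :: nat \<Rightarrow> real. \<epsilon> \<longlonglongrightarrow> 0 \<and>
           (\<forall>\<^sub>F m in sequentially. H_pol TYPE(complex) m (p m) = real m powr (1 + \<epsilon> m))))
   \<and> ((\<lambda>m. p m - ereal (real m)) \<longlonglongrightarrow> 0 \<longrightarrow>
        (\<lambda>m. H_pol TYPE(complex) m (p m) / real m) \<longlonglongrightarrow> 1)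
   \<and> (\<forall>h :: real. 0 < h \<longrightarrow>
        (\<exists>c C :: real. 0 < c \<and> 0 < C \<and>
           (\<forall>\<^sub>F m in sequentially.
              c * real m \<le> H_pol TYPE(complex) m (ereal (real m + h)) \<and>
              H_pol TYPE(complex) m (ereal (real m + h)) \<le> C * real m)))"
proof (intro conjI impI allI)
  let ?HC = "H_pol TYPE(complex)" and ?HR = "H_pol TYPE(real)"
  {
    assume lim: "(\<lambda>m. p m / ereal (real m)) \<longlonglongrightarrow> 1"
    have ev: "\<forall>\<^sub>F m in sequentially. \<bar>?HC m (p m) powr (1 / real m) - 1\<bar> < \<epsilon> \<and>
        \<bar>?HR m (p m) powr (1 / real m) - 2\<bar> < \<epsilon>" if \<epsilon>: "0 < \<epsilon>" for \<epsilon>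
    proof -
      obtain \<delta> where \<delta>: "0 < \<delta>" "\<forall>\<^sub>F m in sequentially. \<forall>s. real m < s \<and> s \<le> real m + \<delta> * real m \<longrightarrow>
        \<bar>?HC m (ereal s) powr (1 / real m) - 1\<bar> < \<epsilon> \<and> \<bar>?HR m (ereal s) powr (1 / real m) - 2\<bar> < \<epsilon>"
        using H_pol_root_uniform[OF \<epsilon>] by blast
      have "\<forall>\<^sub>F m in sequentially. p m / ereal (real m) < ereal (1 + \<delta>)"
        using lim \<delta>(1) by (intro order_tendstoD(2)[OF lim]) (simp add: one_ereal_def)
      with \<delta>(2) show ?thesis using eventually_ge_at_top[of 2]
      proof eventually_elim
        case (elim m)
        have "p m < ereal ((1 + \<delta>) * real m)"
          using elim(2,3) by (cases "p m") (auto simp: field_simps)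
        then obtain s where "p m = ereal s" "real m < s" "s < (1 + \<delta>) * real m"
          using p_gt elim(3) ereal_between_reals by metis
        then show ?case using elim(1) by (simp add: algebra_simps)
      qed
    qed
    show "(\<lambda>m. ?HC m (p m) powr (1 / real m)) \<longlonglongrightarrow> 1"
    proof (rule tendstoI)
      fix e :: real assume "0 < e"
      from ev[OF this] show "\<forall>\<^sub>F m in sequentially. dist (?HC m (p m) powr (1 / real m)) 1 < e"
        by eventually_elim (simp add: dist_real_def)
    qed
    show "(\<lambda>m. ?HR m (p m) powr (1 / real m)) \<longlonglongrightarrow> 2"
    proof (rule tendstoI)
      fix e :: real assume "0 < e"
      from ev[OF this] show "\<forall>\<^sub>F m in sequentially. dist (?HR m (p m) powr (1 / real m)) 2 < e"
        by eventually_elim (simp add: dist_real_def)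
    qed
  }
  {
    fix h :: "nat \<Rightarrow> real"
    assume h: "(\<forall>m\<ge>2. 0 < h m) \<and> (\<lambda>m. h m / real m) \<longlonglongrightarrow> 0"
    let ?S = "\<lambda>m. {ereal (real m)<..ereal (real m + h m)}"
    have ne: "\<forall>\<^sub>F m in sequentially. ?S m \<noteq> {}"
      using eventually_ge_at_top[of 2]
    proof eventually_elim
      case (elim m)
      then have "ereal (real m + h m) \<in> ?S m" using h by simp
      then show ?case by blast
    qed
    have ev: "\<forall>\<^sub>F m in sequentially. \<forall>s\<in>?S m. \<bar>?HC m s powr (1 / real m) - 1\<bar> \<le> \<epsilon> \<and>
        \<bar>?HR m s powr (1 / real m) - 2\<bar> \<le> \<epsilon>" if \<epsilon>: "0 < \<epsilon>" for \<epsilon>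
    proof -
      obtain \<delta> where \<delta>: "0 < \<delta>" "\<forall>\<^sub>F m in sequentially. \<forall>s. real m < s \<and> s \<le> real m + \<delta> * real m \<longrightarrow>
        \<bar>?HC m (ereal s) powr (1 / real m) - 1\<bar> < \<epsilon> \<and> \<bar>?HR m (ereal s) powr (1 / real m) - 2\<bar> < \<epsilon>"
        using H_pol_root_uniform[OF \<epsilon>] by blast
      have "\<forall>\<^sub>F m in sequentially. h m / real m < \<delta>"
        using h \<delta>(1) by (intro order_tendstoD(2)) auto
      with \<delta>(2) show ?thesis using eventually_ge_at_top[of 2]
      proof eventually_elim
        case (elim m)
        have hm: "h m < \<delta> * real m" using elim(2,3) by (simp add: field_simps)
        show ?case
        proof
          fix s assume "s \<in> ?S m"
          then obtain r where "s = ereal r" "real m < r" "r \<le> real m + h m"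
            by (cases s) auto
          then show "\<bar>?HC m s powr (1 / real m) - 1\<bar> \<le> \<epsilon> \<and> \<bar>?HR m s powr (1 / real m) - 2\<bar> \<le> \<epsilon>"
            using elim(1) hm by (auto intro: less_imp_le)
        qed
      qed
    qed
    show "(\<lambda>m. SUP s\<in>?S m. ereal \<bar>?HC m s powr (1 / real m) - 1\<bar>) \<longlonglongrightarrow> 0"
    proof (rule SUP_ereal_tendsto_zero[OF _ ne])
      show "\<forall>\<^sub>F m in sequentially. \<forall>s\<in>?S m. \<bar>?HC m s powr (1 / real m) - 1\<bar> \<le> \<epsilon>" if "0 < \<epsilon>" for \<epsilon>
        using ev[OF that] by (rule eventually_mono) blast
    qed simp
    show "(\<lambda>m. SUP s\<in>?S m. ereal \<bar>?HR m s powr (1 / real m) - 2\<bar>) \<longlonglongrightarrow> 0"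
    proof (rule SUP_ereal_tendsto_zero[OF _ ne])
      show "\<forall>\<^sub>F m in sequentially. \<forall>s\<in>?S m. \<bar>?HR m s powr (1 / real m) - 2\<bar> \<le> \<epsilon>" if "0 < \<epsilon>" for \<epsilon>
        using ev[OF that] by (rule eventually_mono) blast
    qed simp
  }
  {
    assume lim: "(\<lambda>m. (p m - ereal (real m)) / ereal (ln (real m))) \<longlonglongrightarrow> 0"
    have ev: "\<forall>\<^sub>F m in sequentially. 2 \<le> m \<and> (\<exists>s. p m = ereal s \<and> real m < s \<and> s < 2 * real m
        \<and> s - real m < \<delta> * ln (real m))" if \<delta>: "0 < \<delta>" for \<delta>
    proof -
      have "\<forall>\<^sub>F m in sequentially. (p m - ereal (real m)) / ereal (ln (real m)) < ereal (min \<delta> 1)"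
        using \<delta> by (intro order_tendstoD(2)[OF lim]) (simp add: zero_ereal_def)
      then show ?thesis using eventually_ge_at_top[of 2]
      proof eventually_elim
        case (elim m)
        have ln0: "0 < ln (real m)" using elim(2) by simp
        have gt: "ereal (real m) < p m" using p_gt elim(2) by simp
        have "p m \<noteq> \<infinity>"
        proof
          assume "p m = \<infinity>"
          then show False using elim(1) ln0 by simp
        qed
        then obtain s where s: "p m = ereal s" using gt by (cases "p m") auto
        have "(s - real m) / ln (real m) < min \<delta> 1" using elim(1) ln0 by (simp add: s)
        then have "s - real m < min \<delta> 1 * ln (real m)" using ln0 by (simp only: pos_divide_less_eq)
        moreover have "min \<delta> 1 * ln (real m) \<le> \<delta> * ln (real m)" "min \<delta> 1 * ln (real m) \<le> 1 * ln (real m)"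
          using ln0 by (intro mult_right_mono; simp)+
        moreover have "ln (real m) < real m" using ln_less_self[of "real m"] elim(2) by simp
        ultimately have "s < 2 * real m" "s - real m < \<delta> * ln (real m)" by linarith+
        then show ?case using s gt elim(2) by simp
      qed
    qed
    define \<epsilon> where "\<epsilon> m = ln (?HC m (p m)) / ln (real m) - 1" for m
    have "\<epsilon> \<longlonglongrightarrow> 0"
    proof (rule tendstoI)
      fix e :: real assume e: "0 < e"
      have R: "0 < HL_rate" using HL_rate_ge_one by linarith
      have "0 < e / HL_rate" using e R by simp
      from ev[OF this] show "\<forall>\<^sub>F m in sequentially. dist (\<epsilon> m) 0 < e"
      proof eventually_elim
        case (elim m)
        then obtain s where s: "p m = ereal s" "real m < s" "s < 2 * real m"
          "s - real m < e / HL_rate * ln (real m)" by blast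
        have m0: "0 < m" and ln0: "0 < ln (real m)" using elim by auto
        note B = H_pol_complex_bounds[OF m0 s(2,3)]
        have "ln (real m * exp (- (HL_rate * (s - m)))) \<le> ln (?HC m (ereal s))"
          using B(1) m0 by (intro ln_mono) auto
        moreover have "ln (?HC m (ereal s)) \<le> ln (real m * exp (HL_rate * (s - m)))"
          using B(2,3) by (intro ln_mono) auto
        ultimately have "\<bar>ln (?HC m (ereal s)) - ln (real m)\<bar> \<le> HL_rate * (s - m)"
          using m0 by (simp add: ln_mult abs_le_iff)
        also have "\<dots> < e * ln (real m)" using s(4) R by (simp add: field_simps)
        finally have "\<bar>ln (?HC m (ereal s)) - ln (real m)\<bar> / ln (real m) < e"
          using ln0 by (simp add: field_simps)
        moreover have "\<epsilon> m = (ln (?HC m (ereal s)) - ln (real m)) / ln (real m)"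
          using ln0 by (simp add: \<epsilon>_def s(1) field_simps)
        ultimately show ?case using ln0 by (simp add: dist_real_def)
      qed
    qed
    moreover have "\<forall>\<^sub>F m in sequentially. ?HC m (p m) = real m powr (1 + \<epsilon> m)"
      using ev[OF zero_less_one]
    proof eventually_elim
      case (elim m)
      then obtain s where s: "p m = ereal s" "real m < s" "s < 2 * real m" by blast
      have m0: "0 < m" and ln0: "ln (real m) \<noteq> 0" using elim by auto
      have "1 \<le> ?HC m (p m)" unfolding s(1) by (rule H_pol_complex_bounds(3)[OF m0 s(2,3)])
      then show ?case using m0 ln0 by (simp add: \<epsilon>_def powr_def)
    qed
    ultimately show "\<exists>\<epsilon> :: nat \<Rightarrow> real. \<epsilon> \<longlonglongrightarrow> 0 \<and>
        (\<forall>\<^sub>F m in sequentially. ?HC m (p m) = real m powr (1 + \<epsilon> m))" by blast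
  }
  {
    assume lim: "(\<lambda>m. p m - ereal (real m)) \<longlonglongrightarrow> 0"
    show "(\<lambda>m. ?HC m (p m) / real m) \<longlonglongrightarrow> 1"
    proof (rule tendstoI)
      fix e :: real assume e: "0 < e"
      have R: "0 < HL_rate" using HL_rate_ge_one by linarith
      define \<delta> where "\<delta> = min 1 (ln (1 + e) / HL_rate)"
      have \<delta>: "0 < \<delta>" "\<delta> \<le> 1" "HL_rate * \<delta> \<le> ln (1 + e)"
        using e R by (auto simp: \<delta>_def min_def field_simps)
      have "\<forall>\<^sub>F m in sequentially. p m - ereal (real m) < ereal \<delta>"
        using \<delta>(1) by (intro order_tendstoD(2)[OF lim]) (simp add: zero_ereal_def)
      then show "\<forall>\<^sub>F m in sequentially. dist (?HC m (p m) / real m) 1 < e"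
        using eventually_ge_at_top[of 2]
      proof eventually_elim
        case (elim m)
        have "p m < ereal (real m + \<delta>)" using elim(1) by (cases "p m") auto
        then obtain s where s: "p m = ereal s" "real m < s" "s < real m + \<delta>"
          using p_gt elim(2) ereal_between_reals by metis
        have m0: "0 < m" and s2: "s < 2 * real m" using elim(2) s(3) \<delta>(2) by auto
        note B = H_pol_complex_bounds[OF m0 s(2) s2]
        have "HL_rate * (s - m) < HL_rate * \<delta>" using s(3) R by simp
        then have x: "HL_rate * (s - m) < ln (1 + e)" using \<delta>(3) by linarith
        have "?HC m (ereal s) / real m \<le> exp (HL_rate * (s - m))"
          using B(2) m0 by (simp add: field_simps)
        also have "\<dots> < exp (ln (1 + e))" using x by simp
        finally have up: "?HC m (ereal s) / real m < 1 + e" using e by simp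
        have "1 - e < exp (- ln (1 + e))"
          using e by (simp add: exp_minus field_simps power2_eq_square[symmetric])
        also have "\<dots> < exp (- (HL_rate * (s - m)))" using x by simp
        also have "\<dots> \<le> ?HC m (ereal s) / real m" using B(1) m0 by (simp add: field_simps)
        finally show ?case using up by (simp add: s(1) dist_real_def abs_less_iff)
      qed
    qed
  }
  {
    fix h :: real assume h: "0 < h"
    show "\<exists>c C :: real. 0 < c \<and> 0 < C \<and> (\<forall>\<^sub>F m in sequentially.
        c * real m \<le> ?HC m (ereal (real m + h)) \<and> ?HC m (ereal (real m + h)) \<le> C * real m)"
    proof (intro exI conjI)
      show "0 < exp (- (HL_rate * h))" "0 < exp (HL_rate * h)" by simp_all
      show "\<forall>\<^sub>F m in sequentially. exp (- (HL_rate * h)) * real m \<le> ?HC m (ereal (real m + h)) \<and>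
          ?HC m (ereal (real m + h)) \<le> exp (HL_rate * h) * real m"
        using eventually_gt_at_top[of "nat \<lceil>h\<rceil>"]
      proof eventually_elim
        case (elim m)
        have hm: "h < real m" using elim h by linarith
        then have "0 < m" "real m < real m + h" "real m + h < 2 * real m" using h by auto
        from H_pol_complex_bounds(1,2)[OF this] show ?case by (simp add: mult.commute)
      qed
    qed
  }
qed

end
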